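(* Let $K\subset\mathbb{R}^n$ be a convex body. Let $\mu$ be a measure on $\mathbb{R}^n$ given by $d\mu(x)=\phi(x)\,dx$, where $\phi:\mathbb{R}^n\to[0,\infty)$ is radially decreasing. Then $$\mu(K-K)\le\binom{2n}{n}\min\{\overline{\mu}(K),\overline{\mu}(-K)\}.$$ Moreover, if $\phi$ is continuous at the origin, then equality holds if and only if $\mu$ is a constant multiple of the Lebesgue measure on $K-K$ and $K$ is a simplex.
   Context: A convex body in $\mathbb{R}^n$ is a compact convex set with non-empty interior. $A-B=\{a-b: a\in A,\ b\in B\}$. $\mathrm{vol}$ is $n$-dimensional Lebesgue measure. A function $\phi:\mathbb{R}^n\to[0,\infty)$ is radially decreasing if $\phi(tx)\ge\phi(x)$ for all $t\in[0,1]$ and $x\in\mathbb{R}^n$. The translated-average of $\mu$ is defined, for a convex body $K$, by $$\overline{\mu}(K)=\frac{1}{\mathrm{vol}(K)}\int_K\mu(-y+K)\,dy .$$ "$\mu$ is a constant multiple of the Lebesgue measure on $A$" means that there is a constant $c\ge0$ with $\mu(M)=c\,\mathrm{vol}(M)$ for all measurable $M\subset A$.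
   Formalization: The equality characterization is stated for μ not the zero measure: for φ = 0 both sides vanish for every convex body K, so K need not be a simplex when n ≥ 2. Measurability of φ, implicit in dμ = φ dx, is stated explicitly. *)

theory Defs
  imports "HOL-Analysis.Analysis"
begin

definition convex_body :: "'a::euclidean_space set \<Rightarrow> bool" where
  "convex_body K \<longleftrightarrow> compact K \<and> convex K \<and> interior K \<noteq> {}"

definition radially_decreasing :: "('a::real_vector \<Rightarrow> real) \<Rightarrow> bool" where
  "radially_decreasing \<phi> \<longleftrightarrow> (\<forall>t\<in>{0..1}. \<forall>x. \<phi> (t *\<^sub>R x) \<ge> \<phi> x)"

text \<open>The pointwise difference of two sets, not the set-theoretic one (which is written
  \<open>A - B\<close> in HOL).\<close>

definition pointwise_diff :: "'a::minus set \<Rightarrow> 'a set \<Rightarrow> 'a set" where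
  "pointwise_diff A B = {a - b |a b. a \<in> A \<and> b \<in> B}"

text \<open>The average is taken in the extended nonnegative reals; the volume of a convex body is
  positive and finite, so the division is an honest one.\<close>

definition translated_average :: "'a::euclidean_space measure \<Rightarrow> 'a set \<Rightarrow> ennreal" where
  "translated_average \<mu> K =
     1 / emeasure lebesgue K * (\<integral>\<^sup>+ y \<in> K. emeasure \<mu> ((\<lambda>x. - y + x) ` K) \<partial>lebesgue)"

definition constant_multiple_of_lebesgue_on ::
  "'a::euclidean_space measure \<Rightarrow> 'a set \<Rightarrow> bool" where
  "constant_multiple_of_lebesgue_on \<mu> A \<longleftrightarrow>
     (\<exists>c::real. c \<ge> 0 \<and>
        (\<forall>M \<in> sets lebesgue. M \<subseteq> A \<longrightarrow> emeasure \<mu> M = ennreal c * emeasure lebesgue M))"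

end

theory Submission
  imports Defs
begin

text \<open>Write $D = K - K$, $n$ for the dimension, $R$ for the gauge (Minkowski functional) of
  $D$, and \<open>overlap K z\<close> for $K \<inter> (K - z)$. By Fubini, the translated average of
  \<open>\<mu>\<close> over $K$ is the integral of \<open>\<phi>\<close> against the relative volume
  of \<open>overlap K z\<close>. Since the overlaps of $-K$ are reflected translates of those of
  $K$, both averages in the minimum are the same number.

  The inequality. If $z = r (a - b)$ with $a, b \<in> K$ and $r = R(z) \<le> 1$, convexity puts the
  small copy $(1 - r) K + r b$ of $K$ inside \<open>overlap K z\<close>, so the relative volume of
  the overlap is at least $(1 - R(z))^n$. It remains to compare \<open>\<mu> D\<close> with the
  \<open>\<phi>\<close>-integral of $(1 - R)^n$ over $D$. Slicing $(1 - R)^n$ into the dilates $s D$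
  (\<open>layer_cake_gauge\<close>) turns that integral into the average of \<open>\<mu> (s
  D)\<close> with weight $n (1 - s)^{n-1}$ on $[0, 1]$. Radial monotonicity gives \<open>\<mu> (s
  D)\<close> $\<ge> s^n$ \<open>\<mu> D\<close>, and the integral of $n (1 - s)^{n-1} s^n$ is a Beta
  integral, the reciprocal of the central binomial coefficient.

  Equality, analytic half. Both estimates must be tight. Tightness of the second forces \<open>\<mu>
  (s D)\<close> $= s^n$ \<open>\<mu> D\<close> for almost every $s$, and letting $s$ tend to $0$
  identifies \<open>\<phi>\<close> on $D$ with its value at the origin
  (\<open>AE_constant_if_profile_equality\<close>). This value is positive as \<open>\<mu>\<close>
  is not zero, so tightness of the first estimate says that the overlap has relative volume exactly
  $(1 - R(z))^n$, first almost everywhere and then, by continuity, everywhere. Hence every overlap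
  equals the small copy of $K$ inside it.

  Equality, geometric half. A body all of whose overlaps are homothetic to it is a simplex. Order the
  product of the space with \<open>\<real>\<close> by the cone over $K$. The homothety of overlaps
  says that two elements of equal height have a least upper bound. For two distinct extreme points
  of $K$ this bound is their sum, and it follows that anything above several multiples of distinct
  extreme points is above their sum (\<open>extreme_bounds_sum\<close>). Applied to both sides of an
  affine relation between extreme points, this gives a contradiction of heights. So the extreme
  points are affinely independent, and $K$, being their hull, is a simplex. Conversely, in
  barycentric coordinates the overlaps of a simplex are cut out by lower bounds on the coordinates,
  which leaves a homothetic simplex of the right size
  (\<open>measure_overlap_simplex\<close>).\<close>

section \<open>The cone over a convex set and the Minkowski gauge\<close>

text \<open>The dilate \<open>s K\<close> is kept as the slice of one closed cone at height
  \<open>s\<close>. Minkowski sums of dilates then become sums inside the cone, and the cone orders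
  the pairs \<open>(x, s)\<close>, which is what the characterisation of simplices needs.\<close>

definition cone_over :: "'a::euclidean_space set \<Rightarrow> ('a \<times> real) set" where
  "cone_over K = conic hull (K \<times> {1})"

lemma cone_over_iff: "(x, s) \<in> cone_over K \<longleftrightarrow> 0 \<le> s \<and> (\<exists>k\<in>K. x = s *\<^sub>R k)"
  unfolding cone_over_def conic_hull_explicit by auto

lemma closed_cone_over: "compact K \<Longrightarrow> closed (cone_over K)"
  unfolding cone_over_def by (intro closed_conic_hull) (auto intro: compact_Times simp: zero_prod_def)

text \<open>Adding the slices at heights \<open>s\<close> and \<open>t\<close> is a convex
  combination with weights \<open>s / (s + t)\<close> and \<open>t / (s + t)\<close>, rescaled. The
  degenerate case \<open>s + t = 0\<close> only involves the apex.\<close>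

lemma cone_over_add:
  assumes "convex K" "(x, s) \<in> cone_over K" "(y, t) \<in> cone_over K"
  shows "(x + y, s + t) \<in> cone_over K"
proof -
  obtain j k where jk: "j \<in> K" "k \<in> K" "x = s *\<^sub>R j" "y = t *\<^sub>R k" and st: "0 \<le> s" "0 \<le> t"
    using assms(2,3) by (auto simp: cone_over_iff)
  show ?thesis
  proof (cases "s + t = 0")
    case True
    then show ?thesis using jk st by (auto simp: cone_over_iff add_nonneg_eq_0_iff)
  next
    case False
    define m where "m = (s / (s + t)) *\<^sub>R j + (t / (s + t)) *\<^sub>R k"
    have "m \<in> K" unfolding m_def
      using assms(1) jk st False by (intro convexD) (auto simp: add_divide_distrib[symmetric])
    moreover have "x + y = (s + t) *\<^sub>R m"
      using False jk by (simp add: m_def scaleR_add_right)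
    ultimately show ?thesis using st by (auto simp: cone_over_iff)
  qed
qed

lemma cone_over_scale: "0 \<le> c \<Longrightarrow> (x, s) \<in> cone_over K \<Longrightarrow> (c *\<^sub>R x, c * s) \<in> cone_over K"
  by (auto simp: cone_over_iff)

lemma cone_over_sum:
  assumes "convex K" "K \<noteq> {}" "finite S" "\<And>i. i \<in> S \<Longrightarrow> (x i, c i) \<in> cone_over K"
  shows "(sum x S, sum c S) \<in> cone_over K"
  using assms(3,4)
proof (induction S rule: finite_induct)
  case empty
  then show ?case using assms(2) by (auto simp: cone_over_iff)
next
  case (insert i S)
  then show ?case using cone_over_add[OF assms(1), of "x i" "c i" "sum x S" "sum c S"] by simp
qed

definition gauge_fn :: "'a::euclidean_space set \<Rightarrow> 'a \<Rightarrow> real" where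
  "gauge_fn D z = Inf {s. (z, s) \<in> cone_over D}"

context
  fixes D :: "'a::euclidean_space set"
  assumes compact: "compact D" and convex: "convex D" and zero: "0 \<in> interior D"
begin

lemma gauge_levels_nonempty: "\<exists>s. (z, s) \<in> cone_over D"
proof -
  obtain e where e: "e > 0" "cball 0 e \<subseteq> D" using zero by (meson mem_interior_cball)
  define s where "s = norm z / e + 1"
  have s: "s > 0" using e by (simp add: s_def add_nonneg_pos)
  have "norm ((1/s) *\<^sub>R z) \<le> e" using e s by (simp add: s_def field_simps)
  then have "(1/s) *\<^sub>R z \<in> D" using e by auto
  then show ?thesis using s by (intro exI[of _ s]) (auto simp: cone_over_iff intro!: bexI[of _ "(1/s) *\<^sub>R z"])
qed

text \<open>The infimum is attained because the cone is closed, so every \<open>z\<close> is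
  \<open>gauge_fn D z\<close> times a point of \<open>D\<close>.\<close>

lemma gauge_mem: "(z, gauge_fn D z) \<in> cone_over D"
proof -
  have "closed {s. (z, s) \<in> cone_over D}"
    using closed_vimage[OF closed_cone_over[OF compact], of "\<lambda>s. (z, s)"]
    by (simp add: vimage_def continuous_on_Pair)
  moreover have "bdd_below {s. (z, s) \<in> cone_over D}"
    by (auto intro!: bdd_belowI[of _ 0] simp: cone_over_iff)
  ultimately have "Inf {s. (z, s) \<in> cone_over D} \<in> {s. (z, s) \<in> cone_over D}"
    using gauge_levels_nonempty by (intro closed_contains_Inf) auto
  then show ?thesis by (simp add: gauge_fn_def)
qed

lemma gauge_nonneg: "0 \<le> gauge_fn D z"
  using gauge_mem[of z] by (auto simp: cone_over_iff)

lemma gauge_le_iff: "gauge_fn D z \<le> s \<longleftrightarrow> (z, s) \<in> cone_over D"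
proof
  assume s: "gauge_fn D z \<le> s"
  have "0 \<in> D" using zero interior_subset by auto
  then have "(0, s - gauge_fn D z) \<in> cone_over D" using s by (auto simp: cone_over_iff)
  from cone_over_add[OF convex gauge_mem[of z] this] show "(z, s) \<in> cone_over D" by simp
next
  assume "(z, s) \<in> cone_over D"
  then show "gauge_fn D z \<le> s" unfolding gauge_fn_def
    by (intro cInf_lower) (auto intro!: bdd_belowI[of _ 0] simp: cone_over_iff)
qed

lemma gauge_le_1_iff: "gauge_fn D z \<le> 1 \<longleftrightarrow> z \<in> D"
  by (simp add: gauge_le_iff cone_over_iff)

lemma gauge_le_iff_image: "0 \<le> s \<Longrightarrow> gauge_fn D z \<le> s \<longleftrightarrow> z \<in> (\<lambda>x. s *\<^sub>R x) ` D"
  by (auto simp add: gauge_le_iff cone_over_iff)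

lemma gauge_add: "gauge_fn D (x + y) \<le> gauge_fn D x + gauge_fn D y"
  using cone_over_add[OF convex gauge_mem gauge_mem] by (simp add: gauge_le_iff)

lemma gauge_scale: assumes "0 < t" shows "gauge_fn D (t *\<^sub>R x) = t * gauge_fn D x"
proof (rule antisym)
  show "gauge_fn D (t *\<^sub>R x) \<le> t * gauge_fn D x"
    using assms gauge_mem by (simp add: gauge_le_iff cone_over_scale)
  have "gauge_fn D x \<le> (1/t) * gauge_fn D (t *\<^sub>R x)"
    unfolding gauge_le_iff using cone_over_scale[OF _ gauge_mem, of "1/t" "t *\<^sub>R x"] assms by simp
  then show "t * gauge_fn D x \<le> gauge_fn D (t *\<^sub>R x)" using assms by (simp add: field_simps)
qed

text \<open>Subadditivity and positive homogeneity make the gauge convex, and finite convex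
  functions on the whole space are continuous.\<close>

lemma continuous_gauge: "continuous_on UNIV (gauge_fn D)"
proof (rule convex_on_continuous)
  show "convex_on UNIV (gauge_fn D)"
  proof (rule convex_onI)
    fix t :: real and x y :: 'a assume t: "0 < t" "t < 1"
    show "gauge_fn D ((1 - t) *\<^sub>R x + t *\<^sub>R y) \<le> (1 - t) * gauge_fn D x + t * gauge_fn D y"
      using gauge_add[of "(1 - t) *\<^sub>R x" "t *\<^sub>R y"] t by (simp add: gauge_scale)
  qed simp
qed simp

end

section \<open>Overlaps of a convex body with its translates\<close>

definition overlap :: "'a::euclidean_space set \<Rightarrow> 'a \<Rightarrow> 'a set" where
  "overlap K z = {y \<in> K. y + z \<in> K}"

lemma overlap_eq: "overlap K z = K \<inter> (\<lambda>x. - z + x) ` K"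
proof -
  have "y + z \<in> K \<longleftrightarrow> y \<in> (\<lambda>x. - z + x) ` K" for y
    by (auto simp: image_iff algebra_simps intro!: bexI[of _ "y + z"])
  then show ?thesis by (auto simp: overlap_def)
qed

lemma compact_overlap: "compact K \<Longrightarrow> compact (overlap K z)"
  unfolding overlap_eq by (intro compact_Int compact_translation)

lemma convex_overlap: "convex K \<Longrightarrow> convex (overlap K z)"
  unfolding overlap_eq by (intro convex_Int convex_translation)

lemma overlap_empty: "z \<notin> pointwise_diff K K \<Longrightarrow> overlap K z = {}"
  by (force simp: pointwise_diff_def overlap_def)

text \<open>The small homothetic copy of \<open>K\<close> that convexity forces into every overlap.
  Translation by \<open>z\<close> only turns the summand \<open>r b\<close> into \<open>r a\<close>.
  This is the source of the lower bound on the volume of the overlap.\<close>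

lemma overlap_supset:
  assumes "convex K" "a \<in> K" "b \<in> K" "z = r *\<^sub>R (a - b)" "0 \<le> r" "r \<le> 1"
  shows "(\<lambda>k. (1 - r) *\<^sub>R k + r *\<^sub>R b) ` K \<subseteq> overlap K z"
proof clarify
  fix k assume k: "k \<in> K"
  have "(1 - r) *\<^sub>R k + r *\<^sub>R c \<in> K" if "c \<in> K" for c
    using assms k that by (intro convexD) auto
  moreover have "(1 - r) *\<^sub>R k + r *\<^sub>R b + z = (1 - r) *\<^sub>R k + r *\<^sub>R a"
    using assms by (simp add: algebra_simps)
  ultimately show "(1 - r) *\<^sub>R k + r *\<^sub>R b \<in> overlap K z"
    using assms(2,3) unfolding overlap_def by (metis (no_types, lifting) mem_Collect_eq)
qed

lemma compact_pointwise_diff: "compact (K :: 'a::euclidean_space set) \<Longrightarrow> compact (pointwise_diff K K)"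
  unfolding pointwise_diff_def using compact_differences[of K K] by simp

lemma convex_pointwise_diff: "convex (K :: 'a::euclidean_space set) \<Longrightarrow> convex (pointwise_diff K K)"
proof -
  assume "convex K"
  moreover have "pointwise_diff K K = (\<Union>x\<in> K. \<Union>y \<in> K. {x - y})" by (auto simp: pointwise_diff_def)
  ultimately show ?thesis using convex_differences[of K K] by simp
qed

text \<open>Translating \<open>interior K\<close> by one of its own points yields an open
  neighbourhood of the origin inside the difference body.\<close>

lemma zero_interior_pointwise_diff:
  fixes K :: "'a::euclidean_space set"
  assumes "interior K \<noteq> {}" shows "0 \<in> interior (pointwise_diff K K)"
proof -
  obtain k where k: "k \<in> interior K" using assms by auto
  have "(\<lambda>x. - k + x) ` interior K \<subseteq> pointwise_diff K K"
    using k interior_subset by (fastforce simp: pointwise_diff_def)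
  moreover have "open ((\<lambda>x. - k + x) ` interior K)" by (rule open_translation) simp
  moreover have "0 \<in> (\<lambda>x. - k + x) ` interior K" using k by force
  ultimately show ?thesis by (meson interiorI)
qed

abbreviation diff_gauge :: "'a::euclidean_space set \<Rightarrow> 'a \<Rightarrow> real" where
  "diff_gauge K \<equiv> gauge_fn (pointwise_diff K K)"

lemma convex_bodyD: 
  assumes "convex_body K"
  shows "compact K" "convex K" "interior K \<noteq> {}" "compact (pointwise_diff K K)" "convex (pointwise_diff K K)"
    "0 \<in> interior (pointwise_diff K K)" "K \<noteq> {}"
  using assms compact_pointwise_diff[of K] convex_pointwise_diff[of K] zero_interior_pointwise_diff[of K]
  by (auto simp: convex_body_def)

lemma emeasure_convex_body:
  assumes "convex_body K" shows "0 < measure lebesgue K" "emeasure lebesgue K = ennreal (measure lebesgue K)"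
proof -
  show "emeasure lebesgue K = ennreal (measure lebesgue K)"
    using lmeasurable_compact[OF convex_bodyD(1)[OF assms]] by (simp add: emeasure_eq_measure2)
  have "\<not> negligible K"
    using convex_bodyD[OF assms] negligible_convex_interior by blast
  then show "0 < measure lebesgue K"
    using lmeasurable_compact[OF convex_bodyD(1)[OF assms]] negligible_iff_measure0 
    by (metis less_eq_real_def measure_nonneg)
qed

lemma measure_homothet:
  fixes K :: "'a::euclidean_space set"
  shows "measure lebesgue ((\<lambda>k. c *\<^sub>R k + q) ` K) = \<bar>c\<bar> ^ DIM('a) * measure lebesgue K"
  by (rule measure_lebesgue_affine)

lemma diff_gauge_decomp:
  assumes "convex_body K"
  obtains a b where "a \<in> K" "b \<in> K" "z = diff_gauge K z *\<^sub>R (a - b)"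
  using gauge_mem[OF convex_bodyD(4-6)[OF assms], of z] that
  by (auto simp: cone_over_iff pointwise_diff_def)

text \<open>Writing \<open>z\<close> as its gauge times a difference of points of \<open>K\<close>
  gives the best homothety factor in \<open>overlap_supset\<close>. Outside the difference body the
  bound is zero.\<close>

lemma measure_overlap_ge:
  fixes K :: "'a::euclidean_space set"
  assumes "convex_body K"
  shows "measure lebesgue K * (max 0 (1 - diff_gauge K z)) ^ DIM('a) \<le> measure lebesgue (overlap K z)"
proof (cases "diff_gauge K z \<le> 1")
  case True
  note K = convex_bodyD[OF assms]
  obtain a b where ab: "a \<in> K" "b \<in> K" "z = diff_gauge K z *\<^sub>R (a - b)"
    using diff_gauge_decomp[OF assms] by blast
  let ?r = "diff_gauge K z"
  have r0: "0 \<le> ?r" using gauge_nonneg K by blast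
  have sub: "(\<lambda>k. (1 - ?r) *\<^sub>R k + ?r *\<^sub>R b) ` K \<subseteq> overlap K z"
    using overlap_supset[OF K(2) ab r0 True] by simp
  have m: "overlap K z \<in> lmeasurable" using K by (simp add: lmeasurable_compact compact_overlap)
  have "compact ((\<lambda>k. (1 - ?r) *\<^sub>R k + ?r *\<^sub>R b) ` K)"
    using K by (intro compact_continuous_image) (auto intro!: continuous_intros)
  then have "measure lebesgue ((\<lambda>k. (1 - ?r) *\<^sub>R k + ?r *\<^sub>R b) ` K) \<le> measure lebesgue (overlap K z)"
    using measure_mono_fmeasurable[OF sub _ m] lmeasurable_compact fmeasurableD by blast
  then show ?thesis using True by (simp add: measure_homothet mult.commute)
next
  case False
  then show ?thesis by (simp add: zero_power)
qed

text \<open>The indicators of the overlaps converge pointwise except where \<open>x + z\<close> hits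
  the frontier of \<open>K\<close>, which is negligible for a convex set, and all of them live on
  \<open>K\<close>: dominated convergence applies. Continuity is what upgrades an almost-everywhere
  identity of overlap volumes to all translations.\<close>

lemma continuous_measure_overlap:
  fixes K :: "'a::euclidean_space set"
  assumes "compact K" "convex K"
  shows "continuous_on UNIV (\<lambda>z. measure lebesgue (overlap K z))"
proof (rule continuous_on_sequentiallyI)
  fix u :: "nat \<Rightarrow> 'a" and z assume u: "u \<longlonglongrightarrow> z"
  have eq: "measure lebesgue (overlap K z) = (\<integral>x. indicator (overlap K z) x \<partial>lebesgue)" for z
    by simp
  have fr: "negligible ((\<lambda>x. - z + x) ` frontier K)"
    using negligible_convex_frontier[OF assms(2)] by (rule negligible_translation)
  have m: "overlap K z \<in> sets lebesgue" for z
    using lmeasurable_compact[OF compact_overlap[OF assms(1)]] fmeasurableD by blast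
  have "(\<lambda>n. \<integral>x. (indicator (overlap K (u n)) x :: real) \<partial>lebesgue) \<longlonglongrightarrow> (\<integral>x. indicator (overlap K z) x \<partial>lebesgue)"
  proof (rule integral_dominated_convergence[where w = "indicator K"])
    show "integrable lebesgue (indicat_real K)"
      using lmeasurable_compact[OF assms(1)] by (simp add: lmeasurable_iff_integrable)
    show "AE x in lebesgue. (\<lambda>n. indicat_real (overlap K (u n)) x) \<longlonglongrightarrow> indicator (overlap K z) x"
    proof (rule AE_I'[of "(\<lambda>x. - z + x) ` frontier K"])
      show "(+) (- z) ` frontier K \<in> null_sets lebesgue"
        using fr negligible_iff_null_sets by blast
      show "{x \<in> space lebesgue. \<not> (\<lambda>n. indicat_real (overlap K (u n)) x) \<longlonglongrightarrow> indicator (overlap K z) x}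
          \<subseteq> (+) (- z) ` frontier K"
      proof (rule ccontr)
        assume "\<not> ?thesis"
        then obtain x where x: "\<not> (\<lambda>n. indicat_real (overlap K (u n)) x) \<longlonglongrightarrow> indicator (overlap K z) x"
          and nx: "x \<notin> (+) (- z) ` frontier K" by auto
        have "x + z \<notin> frontier K"
        proof
          assume "x + z \<in> frontier K"
          then have "- z + (x + z) \<in> (+) (- z) ` frontier K" by (rule imageI)
          with nx show False by simp
        qed
        then consider "x + z \<in> interior K" | "x + z \<in> - K"
          using assms(1) by (auto simp: frontier_def compact_imp_closed)
        then have "eventually (\<lambda>n. x + u n \<in> K \<longleftrightarrow> x + z \<in> K) sequentially"
        proof cases
          case 1
          have "(\<lambda>n. x + u n) \<longlonglongrightarrow> x + z" using u by (intro tendsto_intros)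
          from topological_tendstoD[OF this open_interior 1]
          show ?thesis using 1 interior_subset by (auto elim!: eventually_mono)
        next
          case 2
          have "(\<lambda>n. x + u n) \<longlonglongrightarrow> x + z" using u by (intro tendsto_intros)
          from topological_tendstoD[OF this _ 2]
          show ?thesis using 2 assms(1) by (auto simp: compact_imp_closed open_Compl elim!: eventually_mono)
        qed
        then have "eventually (\<lambda>n. indicat_real (overlap K (u n)) x = indicator (overlap K z) x) sequentially"
          by (rule eventually_mono) (auto simp: overlap_def indicator_def)
        then show False using x by (simp add: tendsto_eventually)
      qed
    qed
    show "AE x in lebesgue. norm (indicat_real (overlap K (u n)) x) \<le> indicator K x" for n
      by (auto simp: overlap_def indicator_def)
  qed (use m in auto)
  then show "(\<lambda>n. measure lebesgue (overlap K (u n))) \<longlonglongrightarrow> measure lebesgue (overlap K z)"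
    by (simp only: eq)
qed

section \<open>Bodies with homothetic overlaps are simplices\<close>

text \<open>This is the statement that each overlap is contained in the homothetic copy of
  \<open>K\<close> of \<open>overlap_supset\<close>, hence equal to it. In the order of the cone it
  reads: \<open>y - R b\<close> is still above the apex after its height has dropped from
  \<open>1\<close> to \<open>1 - R\<close>.\<close>

definition homothetic_overlaps :: "'a::euclidean_space set \<Rightarrow> bool" where
  "homothetic_overlaps K \<longleftrightarrow> (\<forall>y z a b. y \<in> K \<longrightarrow> y + z \<in> K \<longrightarrow> a \<in> K \<longrightarrow> b \<in> K \<longrightarrow>
     z = diff_gauge K z *\<^sub>R (a - b) \<longrightarrow>
     (y - diff_gauge K z *\<^sub>R b, 1 - diff_gauge K z) \<in> cone_over K)"

text \<open>If a point of \<open>T\<close> were missing from the closed set \<open>S\<close>, so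
  would be a neighbourhood of it, and this neighbourhood meets the interior of \<open>T\<close> in
  an open set of positive volume.\<close>

lemma compact_subset_eq_if_measure_le:
  fixes S T :: "'a::euclidean_space set"
  assumes "compact S" "compact T" "convex T" "S \<subseteq> T" "interior S \<noteq> {}"
    and le: "measure lebesgue T \<le> measure lebesgue S"
  shows "S = T"
proof (rule ccontr)
  assume "S \<noteq> T"
  then obtain x where x: "x \<in> T" "x \<notin> S" using assms(4) by auto
  have "interior T \<noteq> {}" using assms(4,5) interior_mono by blast
  then have "x \<in> closure (interior T)"
    using x convex_closure_interior[OF assms(3)] closure_subset by auto
  moreover have o: "open (- S)" using assms(1) by (simp add: compact_imp_closed open_Compl)
  ultimately have ne: "- S \<inter> interior T \<noteq> {}"
    using x open_Int_closure_eq_empty[of "- S" "interior T"] by blast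
  have "negligible (T - S)"
  proof -
    have m: "S \<in> lmeasurable" "T \<in> lmeasurable" using assms lmeasurable_compact by auto
    then have "measure lebesgue (T - S) = measure lebesgue T - measure lebesgue S"
      using assms(4) by (intro measurable_measure_Diff) (auto simp: fmeasurableD)
    also have "\<dots> \<le> 0" using le by simp
    finally have "measure lebesgue (T - S) = 0" using measure_nonneg by (metis antisym)
    then show ?thesis using m negligible_iff_measure fmeasurable.Diff by blast
  qed
  then have "negligible (- S \<inter> interior T)"
    by (rule negligible_subset) (use interior_subset in auto)
  moreover have "open (- S \<inter> interior T)" using o by (simp add: open_Int)
  ultimately show False using ne open_not_negligible by blast
qed

text \<open>For gauge less than one the homothetic copy has interior points and full volume, so it
  fills the overlap. On the boundary of the difference body the copy degenerates to a point and
  volume says nothing; there \<open>z\<close> is shrunk to \<open>t z\<close> with \<open>t <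
  1\<close> and the conclusion survives the limit since the cone is closed.\<close>

lemma homothetic_overlaps_if_measure_eq:
  fixes K :: "'a::euclidean_space set"
  assumes K: "convex_body K"
    and eq: "\<And>z. measure lebesgue (overlap K z) = measure lebesgue K * (max 0 (1 - diff_gauge K z)) ^ DIM('a)"
  shows "homothetic_overlaps K"
proof -
  note Kb = convex_bodyD[OF K]
  have small: "(y - diff_gauge K z *\<^sub>R b, 1 - diff_gauge K z) \<in> cone_over K"
    if y: "y \<in> K" "y + z \<in> K" and ab: "a \<in> K" "b \<in> K" "z = diff_gauge K z *\<^sub>R (a - b)"
      and lt: "diff_gauge K z < 1" for y z a b
  proof -
    let ?r = "diff_gauge K z"
    let ?S = "(\<lambda>k. (1 - ?r) *\<^sub>R k + ?r *\<^sub>R b) ` K"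
    have r0: "0 \<le> ?r" using gauge_nonneg Kb by blast
    have "?S = overlap K z"
    proof (rule compact_subset_eq_if_measure_le)
      show c: "compact ?S" using Kb by (intro compact_continuous_image) (auto intro!: continuous_intros)
      show "compact (overlap K z)" "convex (overlap K z)"
        using Kb by (auto intro: compact_overlap convex_overlap)
      show "?S \<subseteq> overlap K z" using overlap_supset[OF Kb(2) ab r0] lt by simp
      have m: "measure lebesgue ?S = (1 - ?r) ^ DIM('a) * measure lebesgue K"
        using lt by (simp add: measure_homothet)
      then show "measure lebesgue (overlap K z) \<le> measure lebesgue ?S"
        using lt by (simp add: eq mult.commute)
      have "convex ?S"
        using convex_affinity[OF Kb(2), of "?r *\<^sub>R b" "1 - ?r"] by (simp add: add.commute)
      moreover have "measure lebesgue ?S > 0" using m lt emeasure_convex_body(1)[OF K] by simp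
      then have "\<not> negligible ?S" using negligible_imp_measure0 by fastforce
      ultimately show "interior ?S \<noteq> {}" using negligible_convex_interior by blast
    qed
    moreover have "y \<in> overlap K z" using y by (simp add: overlap_def)
    ultimately obtain k where "k \<in> K" "y = (1 - ?r) *\<^sub>R k + ?r *\<^sub>R b" by blast
    then show ?thesis using lt by (auto simp: cone_over_iff)
  qed
  have "(y - diff_gauge K z *\<^sub>R b, 1 - diff_gauge K z) \<in> cone_over K"
    if y: "y \<in> K" "y + z \<in> K" and ab: "a \<in> K" "b \<in> K" "z = diff_gauge K z *\<^sub>R (a - b)" for y z a b
  proof -
    let ?r = "diff_gauge K z"
    have "z \<in> pointwise_diff K K" using y by (force simp: pointwise_diff_def)
    then have r1: "?r \<le> 1" using gauge_le_1_iff Kb by blast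
    have r0: "0 \<le> ?r" using gauge_nonneg Kb by blast
    obtain k where k: "k \<in> K" using Kb by auto
    define t where "t = (\<lambda>n::nat. real n / real (Suc n))"
    have t01: "0 \<le> t n" "t n < 1" for n by (auto simp: t_def)
    have tl: "t \<longlonglongrightarrow> 1" unfolding t_def by (rule LIMSEQ_n_over_Suc_n)
    \<comment> \<open>Moving \<open>y\<close> towards a fixed point of \<open>K\<close> keeps it in the overlap with the shrunk translation.\<close>
    let ?y = "\<lambda>n. (1 - t n) *\<^sub>R k + t n *\<^sub>R y"
    have "(?y n - (t n * ?r) *\<^sub>R b, 1 - t n * ?r) \<in> cone_over K" for n
    proof (cases "t n = 0")
      case True
      then show ?thesis using k by (auto simp: cone_over_iff)
    next
      case False
      have g: "diff_gauge K (t n *\<^sub>R z) = t n * ?r"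
        using gauge_scale[OF Kb(4-6), of "t n" z] t01[of n] False by (simp add: less_le)
      have inK: "(1 - t n) *\<^sub>R k + t n *\<^sub>R c \<in> K" if "c \<in> K" for c
        using that k t01[of n] Kb(2) by (intro convexD) auto
      have "?y n + t n *\<^sub>R z = (1 - t n) *\<^sub>R k + t n *\<^sub>R (y + z)" by (simp add: algebra_simps)
      then have *: "?y n \<in> K" "?y n + t n *\<^sub>R z \<in> K" using inK[OF y(1)] inK[OF y(2)] by metis+
      have z: "t n *\<^sub>R z = diff_gauge K (t n *\<^sub>R z) *\<^sub>R (a - b)"
        unfolding g by (subst ab(3)) simp
      have "t n * ?r \<le> t n * 1" using t01[of n] r1 by (intro mult_left_mono) auto
      then have "t n * ?r < 1" using t01[of n] by simp
      then show ?thesis using small[OF * ab(1,2) z] by (simp add: g)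
    qed
    moreover have "(\<lambda>n. (?y n - (t n * ?r) *\<^sub>R b, 1 - t n * ?r)) \<longlonglongrightarrow>
        ((1 - 1) *\<^sub>R k + 1 *\<^sub>R y - (1 * ?r) *\<^sub>R b, 1 - 1 * ?r)"
      by (intro tendsto_intros tl)
    ultimately have "((1 - 1) *\<^sub>R k + 1 *\<^sub>R y - (1 * ?r) *\<^sub>R b, 1 - 1 * ?r) \<in> cone_over K"
      by (rule closed_sequentially[OF closed_cone_over[OF Kb(1)]])
    then show ?thesis by simp
  qed
  then show ?thesis unfolding homothetic_overlaps_def by blast
qed

text \<open>Rescaling to height one carries the property to every height \<open>t\<close>. The bound
  \<open>(R b, R)\<close> does not depend on \<open>t\<close>: this uniformity makes it a genuine
  least upper bound of two cone elements, and comes from the homogeneity of the gauge.\<close>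

lemma homothetic_overlaps_cone:
  assumes K: "convex_body K" and H: "homothetic_overlaps K"
    and v: "(v, t) \<in> cone_over K" "(v + z, t) \<in> cone_over K"
    and ab: "a \<in> K" "b \<in> K" "z = diff_gauge K z *\<^sub>R (a - b)"
  shows "(v - diff_gauge K z *\<^sub>R b, t - diff_gauge K z) \<in> cone_over K"
proof (cases "t = 0")
  note Kb = convex_bodyD[OF K]
  case True
  then have [simp]: "v = 0" "z = 0" using v by (auto simp: cone_over_iff)
  have "diff_gauge K 0 \<le> 0" using Kb gauge_le_iff[OF Kb(4-6), of 0 0] zero_interior_pointwise_diff interior_subset
    by (force simp: cone_over_iff)
  then have [simp]: "diff_gauge K 0 = 0" using gauge_nonneg[OF Kb(4-6), of 0] by linarith
  show ?thesis using True Kb by (auto simp: cone_over_iff)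
next
  note Kb = convex_bodyD[OF K]
  case False
  then have t: "t > 0" using v by (auto simp: cone_over_iff)
  let ?r = "diff_gauge K z"
  have g: "diff_gauge K ((1/t) *\<^sub>R z) = ?r / t"
    using gauge_scale[OF Kb(4-6), of "1/t" z] t by simp
  have z: "(1/t) *\<^sub>R z = diff_gauge K ((1/t) *\<^sub>R z) *\<^sub>R (a - b)"
    unfolding g by (subst ab(3)) simp
  have "(1/t) *\<^sub>R v \<in> K" "(1/t) *\<^sub>R v + (1/t) *\<^sub>R z \<in> K"
    using v t by (auto simp: cone_over_iff scaleR_add_right[symmetric] simp del: scaleR_add_right)
  with H z ab(1,2) have "((1/t) *\<^sub>R v - diff_gauge K ((1/t) *\<^sub>R z) *\<^sub>R b,
      1 - diff_gauge K ((1/t) *\<^sub>R z)) \<in> cone_over K"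
    unfolding homothetic_overlaps_def by blast
  then have "((1/t) *\<^sub>R v - (?r/t) *\<^sub>R b, 1 - ?r/t) \<in> cone_over K" by (simp only: g)
  from cone_over_scale[OF _ this, of t] show ?thesis
    using t by (simp add: scaleR_diff_right right_diff_distrib)
qed

lemma extreme_point_combination:
  assumes "x extreme_point_of K" "b \<in> K" "k \<in> K" "x = r *\<^sub>R b + (1 - r) *\<^sub>R k" "0 < r" "r < 1"
  shows "b = x"
proof -
  have "k = b" 
  proof (rule ccontr)
    assume "k \<noteq> b"
    then have "x \<in> open_segment k b" using assms by (auto simp: in_segment intro!: exI[of _ r])
    then show False using assms by (auto simp: extreme_point_of_def)
  qed
  then show ?thesis using assms by (simp add: scaleR_add_left[symmetric])
qed

text \<open>Read \<open>(q, h) \<in> cone_over K\<close> as "\<open>(q, h)\<close> lies above the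
  apex". The hypotheses say that \<open>(p, s)\<close> is an upper bound of \<open>(x, 1)\<close>
  and \<open>(y, 1)\<close>. Their least upper bound is \<open>(x + R a, 1 + R)\<close>, and it lies
  below the obvious upper bound \<open>(x + y, 2)\<close>. The gap is a multiple \<open>(1 - R)
  k\<close> that lies below both \<open>x\<close> and \<open>y\<close>. Extremality would make
  \<open>k\<close> equal to both of them unless the gap vanishes, so the least upper bound is the
  sum.\<close>

lemma extreme_bounds_add_unit:
  assumes K: "convex_body K" and H: "homothetic_overlaps K"
    and xy: "x extreme_point_of K" "y extreme_point_of K" "x \<noteq> y"
    and p: "(p - x, s - 1) \<in> cone_over K" "(p - y, s - 1) \<in> cone_over K"
  shows "(p - x - y, s - 2) \<in> cone_over K"
proof -
  note Kb = convex_bodyD[OF K]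
  have xyK: "x \<in> K" "y \<in> K" using xy by (auto simp: extreme_point_of_def)
  define r where "r = diff_gauge K (y - x)"
  obtain a b where ab: "a \<in> K" "b \<in> K" "y - x = r *\<^sub>R (a - b)"
    using diff_gauge_decomp[OF K, of "y - x"] unfolding r_def by blast
  have "y - x \<in> pointwise_diff K K" using xyK by (auto simp: pointwise_diff_def)
  then have r01: "0 \<le> r" "r \<le> 1"
    using gauge_nonneg[OF Kb(4-6)] gauge_le_1_iff[OF Kb(4-6)] by (auto simp: r_def)
  have "(x - r *\<^sub>R b, 1 - r) \<in> cone_over K"
    unfolding r_def
  proof (rule homothetic_overlaps_cone[OF K H _ _ ab(1,2)])
    show "(x, 1) \<in> cone_over K" "(x + (y - x), 1) \<in> cone_over K" using xyK by (auto simp: cone_over_iff)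
    show "y - x = diff_gauge K (y - x) *\<^sub>R (a - b)" using ab r_def by simp
  qed
  then obtain k where k: "k \<in> K" "x - r *\<^sub>R b = (1 - r) *\<^sub>R k" by (auto simp: cone_over_iff)
  have x: "x = r *\<^sub>R b + (1 - r) *\<^sub>R k" using k by (simp add: algebra_simps)
  have y: "y = r *\<^sub>R a + (1 - r) *\<^sub>R k"
  proof -
    have "y = x + r *\<^sub>R (a - b)" using ab(3) by (metis add.commute diff_add_cancel)
    also have "\<dots> = r *\<^sub>R b + (1 - r) *\<^sub>R k + r *\<^sub>R (a - b)" using x by simp
    finally show ?thesis by (simp add: algebra_simps)
  qed
  have "r \<noteq> 0" using ab xy by auto
  moreover have "\<not> (0 < r \<and> r < 1)"
  proof
    assume r: "0 < r \<and> r < 1"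
    have "k = x" using extreme_point_combination[OF xy(1) k(1) ab(2), of "1 - r"] x r by (simp add: add.commute)
    moreover have "k = y" using extreme_point_combination[OF xy(2) k(1) ab(1), of "1 - r"] y r by (simp add: add.commute)
    ultimately show False using xy by simp
  qed
  ultimately have r1: "r = 1" using r01 by linarith
  then have bx: "b = x" using x by simp
  have "(p - y - r *\<^sub>R b, s - 1 - r) \<in> cone_over K"
    unfolding r_def
  proof (rule homothetic_overlaps_cone[OF K H _ _ ab(1,2)])
    show "(p - y, s - 1) \<in> cone_over K" "(p - y + (y - x), s - 1) \<in> cone_over K" using p by simp_all
    show "y - x = diff_gauge K (y - x) *\<^sub>R (a - b)" using ab r_def by simp
  qed
  then show ?thesis using r1 bx by (simp add: algebra_simps)
qed

text \<open>Unequal multiples are made equal by raising \<open>p\<close>: if \<open>c \<le>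
  d\<close>, then \<open>p + (d - c) x\<close> is above both \<open>d x\<close> and \<open>d
  y\<close>, hence above \<open>d x + d y\<close>, and the added term can be cancelled.\<close>

lemma extreme_bounds_add:
  assumes K: "convex_body K" and H: "homothetic_overlaps K"
    and xy: "x extreme_point_of K" "y extreme_point_of K" "x \<noteq> y"
    and c: "0 \<le> c" "0 \<le> d"
    and p: "(p - c *\<^sub>R x, s - c) \<in> cone_over K" "(p - d *\<^sub>R y, s - d) \<in> cone_over K"
  shows "(p - c *\<^sub>R x - d *\<^sub>R y, s - c - d) \<in> cone_over K"
proof -
  note Kb = convex_bodyD[OF K]
  have same: "(q - t *\<^sub>R u - t *\<^sub>R w, h - t - t) \<in> cone_over K"
    if uw: "u extreme_point_of K" "w extreme_point_of K" "u \<noteq> w" and t: "0 \<le> t"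
      and q: "(q - t *\<^sub>R u, h - t) \<in> cone_over K" "(q - t *\<^sub>R w, h - t) \<in> cone_over K" for q h t u w
  proof (cases "t = 0")
    case True
    then show ?thesis using q by simp
  next
    case False
    then have t: "t > 0" using t by simp
    have "((1/t) *\<^sub>R q - v, h/t - 1) \<in> cone_over K" if "(q - t *\<^sub>R v, h - t) \<in> cone_over K" for v
      using cone_over_scale[OF _ that, of "1/t"] t by (simp add: scaleR_diff_right diff_divide_distrib)
    then have "((1/t) *\<^sub>R q - u - w, h/t - 2) \<in> cone_over K"
      using extreme_bounds_add_unit[OF K H uw] q by blast
    from cone_over_scale[OF _ this, of t] t show ?thesis
      by (simp add: scaleR_diff_right right_diff_distrib algebra_simps)
  qed
  have step: "(p - c *\<^sub>R x - d *\<^sub>R y, s - c - d) \<in> cone_over K"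
    if le: "c \<le> d" and xy: "x extreme_point_of K" "y extreme_point_of K" "x \<noteq> y"
      and c: "0 \<le> c" and p: "(p - c *\<^sub>R x, s - c) \<in> cone_over K" "(p - d *\<^sub>R y, s - d) \<in> cone_over K"
    for c d x y
  proof -
    have "((d - c) *\<^sub>R x, d - c) \<in> cone_over K"
      using le xy by (auto simp: cone_over_iff extreme_point_of_def)
    from cone_over_add[OF Kb(2) p(2) this]
    have "(p + (d - c) *\<^sub>R x - d *\<^sub>R y, s + (d - c) - d) \<in> cone_over K" by (simp add: algebra_simps)
    moreover have "(p + (d - c) *\<^sub>R x - d *\<^sub>R x, s + (d - c) - d) \<in> cone_over K"
      using p(1) by (simp add: algebra_simps)
    ultimately have "(p + (d - c) *\<^sub>R x - d *\<^sub>R x - d *\<^sub>R y, s + (d - c) - d - d) \<in> cone_over K"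
      using le c by (intro same[OF xy]) auto
    then show ?thesis by (simp add: algebra_simps)
  qed
  show ?thesis
  proof (cases "c \<le> d")
    case True
    then show ?thesis using step xy c p by blast
  next
    case False
    then have "(p - d *\<^sub>R y - c *\<^sub>R x, s - d - c) \<in> cone_over K"
      using step[of d c y x] xy c p by simp
    then show ?thesis by (simp add: algebra_simps)
  qed
qed

text \<open>Peel off one extreme point at a time: by the two-point case, \<open>p\<close> minus the
  multiple of \<open>x\<close> still dominates each remaining multiple.\<close>

lemma extreme_bounds_sum:
  assumes K: "convex_body K" and H: "homothetic_overlaps K"
    and "finite S" and "\<And>e. e \<in> S \<Longrightarrow> e extreme_point_of K" and c: "\<And>e. e \<in> S \<Longrightarrow> 0 \<le> c e"
    and "(p, s) \<in> cone_over K"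
    and "\<And>e. e \<in> S \<Longrightarrow> (p - c e *\<^sub>R e, s - c e) \<in> cone_over K"
  shows "(p - (\<Sum>e\<in>S. c e *\<^sub>R e), s - sum c S) \<in> cone_over K"
  using assms(3-7)
proof (induction S arbitrary: p s rule: finite_induct)
  case empty
  then show ?case by simp
next
  case (insert x S)
  have "(p - c x *\<^sub>R x - (\<Sum>e\<in>S. c e *\<^sub>R e), s - c x - sum c S) \<in> cone_over K"
  proof (rule insert.IH)
    fix e assume e: "e \<in> S"
    then show "(p - c x *\<^sub>R x - c e *\<^sub>R e, s - c x - c e) \<in> cone_over K"
      using insert.hyps insert.prems by (intro extreme_bounds_add[OF K H]) auto
  qed (use insert.prems in auto)
  then show ?case using insert.hyps by (simp add: algebra_simps)
qed

text \<open>An affine relation among extreme points, with its negative terms moved to the other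
  side, presents one cone element \<open>(p, s)\<close> as two sums without common terms. It
  dominates every single term of both sums, hence the total of all of them, whose height is \<open>2
  s > s\<close>.\<close>

lemma simplex_if_homothetic_overlaps:
  fixes K :: "'a::euclidean_space set"
  assumes K: "convex_body K" and H: "homothetic_overlaps K"
  shows "int DIM('a) simplex K"
proof -
  note Kb = convex_bodyD[OF K]
  define E where "E = {x. x extreme_point_of K}"
  have KE: "K = convex hull E" unfolding E_def using Krein_Milman_Minkowski Kb by blast
  have ind: "\<not> affine_dependent E"
  proof
    assume "affine_dependent E"
    then obtain S u where S: "finite S" "S \<subseteq> E" "sum u S = 0" "\<exists>v\<in>S. u v \<noteq> 0" "(\<Sum>v\<in>S. u v *\<^sub>R v) = 0"
      unfolding affine_dependent_explicit by blast
    have SK: "v \<in> K" if "v \<in> S" for v using that S by (auto simp: E_def extreme_point_of_def)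
    define pos where "pos v = max 0 (u v)" for v
    define neg where "neg v = max 0 (- u v)" for v
    have pn: "pos v - neg v = u v" "pos v + neg v = \<bar>u v\<bar>" "0 \<le> pos v" "0 \<le> neg v" for v
      by (auto simp: pos_def neg_def)
    define p where "p = (\<Sum>v\<in>S. pos v *\<^sub>R v)"
    define s where "s = sum pos S"
    have s': "s = sum neg S"
    proof -
      have "sum pos S - sum neg S = 0" using S pn by (simp add: sum_subtractf[symmetric])
      then show ?thesis by (simp add: s_def)
    qed
    have p': "p = (\<Sum>v\<in>S. neg v *\<^sub>R v)"
    proof -
      have "p - (\<Sum>v\<in>S. neg v *\<^sub>R v) = 0"
        using S pn by (simp add: p_def sum_subtractf[symmetric] scaleR_diff_left[symmetric])
      then show ?thesis by simp
    qed
    have ge: "((\<Sum>v\<in>S. w v *\<^sub>R v) - w e *\<^sub>R e, sum w S - w e) \<in> cone_over K"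
      if "e \<in> S" "\<And>v. 0 \<le> w v" for e w
    proof -
      have "((\<Sum>v\<in>S - {e}. w v *\<^sub>R v), sum w (S - {e})) \<in> cone_over K"
        using S Kb SK that by (intro cone_over_sum) (auto simp: cone_over_iff)
      then show ?thesis using that S by (simp add: sum_diff1)
    qed
    have "(p - (\<Sum>v\<in>S. \<bar>u v\<bar> *\<^sub>R v), s - (\<Sum>v\<in>S. \<bar>u v\<bar>)) \<in> cone_over K"
    proof (rule extreme_bounds_sum[OF K H])
      show "(p, s) \<in> cone_over K"
        unfolding p_def s_def using S Kb SK pn by (intro cone_over_sum) (auto simp: cone_over_iff)
      fix e assume e: "e \<in> S"
      show "(p - \<bar>u e\<bar> *\<^sub>R e, s - \<bar>u e\<bar>) \<in> cone_over K"
      proof (cases "0 \<le> u e")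
        case True
        then have "\<bar>u e\<bar> = pos e" by (simp add: pos_def)
        then show ?thesis using ge[OF e, of pos] pn by (simp add: p_def s_def)
      next
        case False
        then have "\<bar>u e\<bar> = neg e" by (simp add: neg_def)
        then show ?thesis using ge[OF e, of neg] pn by (simp add: p' s')
      qed
    qed (use S in \<open>auto simp: E_def\<close>)
    then have "(\<Sum>v\<in>S. \<bar>u v\<bar>) \<le> s" by (simp add: cone_over_iff)
    moreover have "(\<Sum>v\<in>S. \<bar>u v\<bar>) = s + s"
    proof -
      have "(\<Sum>v\<in>S. \<bar>u v\<bar>) = sum pos S + sum neg S" by (simp add: pn(2)[symmetric] sum.distrib)
      then show ?thesis using s_def s' by simp
    qed
    moreover obtain v where "v \<in> S" "u v \<noteq> 0" using S by blast
    then have "0 < (\<Sum>v\<in>S. \<bar>u v\<bar>)"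
      using S by (intro sum_pos2[of S v]) auto
    ultimately show False by linarith
  qed
  have "aff_dim E = int DIM('a)"
    using KE Kb(3) aff_dim_convex_hull[of E] aff_dim_nonempty_interior[of K] by simp
  then have "int (card E) = int DIM('a) + 1"
    using aff_dim_affine_independent[OF ind] by simp
  then show ?thesis unfolding simplex_def using ind KE by blast
qed

text \<open>Let \<open>l\<close> be the difference of the barycentric coordinates of \<open>y +
  z\<close> and \<open>y\<close>. By affine independence it depends on \<open>z\<close> only. A
  point of the overlap has each coordinate at least the negative part of \<open>l\<close>, and
  removing those amounts leaves an element of \<open>(1 - m) K\<close>, where \<open>m\<close> is
  the sum of the negative parts. The positive and negative parts of \<open>l\<close> also exhibit
  \<open>z\<close> in the \<open>m\<close>-fold difference body, so \<open>m\<close> bounds the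
  gauge from above.\<close>

lemma measure_overlap_simplex:
  fixes K :: "'a::euclidean_space set"
  assumes K: "convex_body K" and sim: "n simplex K"
  shows "measure lebesgue (overlap K z) \<le> measure lebesgue K * (max 0 (1 - diff_gauge K z)) ^ DIM('a)"
proof (cases "overlap K z = {}")
  case True
  then show ?thesis by simp
next
  case False
  note Kb = convex_bodyD[OF K]
  obtain C where C: "finite C" "\<not> affine_dependent C" "K = convex hull C"
    using sim aff_independent_finite by (auto simp: simplex_def)
  have CK: "C \<subseteq> K" using C hull_subset by metis
  have coords: "\<exists>u. (\<forall>v\<in>C. 0 \<le> u v) \<and> sum u C = 1 \<and> (\<Sum>v\<in>C. u v *\<^sub>R v) = y" if "y \<in> K" for y
    using that C convex_hull_finite[OF C(1)] by auto
  have uniq: "u v = 0" if "sum u C = 0" "(\<Sum>v\<in>C. u v *\<^sub>R v) = 0" "v \<in> C" for u v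
    using that C affine_dependent_explicit_finite[OF C(1)] by blast
  obtain y0 where y0: "y0 \<in> K" "y0 + z \<in> K" using False by (auto simp: overlap_def)
  obtain u where u: "\<forall>v\<in>C. 0 \<le> u v" "sum u C = 1" "(\<Sum>v\<in>C. u v *\<^sub>R v) = y0"
    using coords[OF y0(1)] by blast
  obtain w where w: "\<forall>v\<in>C. 0 \<le> w v" "sum w C = 1" "(\<Sum>v\<in>C. w v *\<^sub>R v) = y0 + z"
    using coords[OF y0(2)] by blast
  define l where "l v = w v - u v" for v
  have l: "sum l C = 0" "(\<Sum>v\<in>C. l v *\<^sub>R v) = z"
    using u w by (simp_all add: l_def sum_subtractf scaleR_diff_left)
  define pos where "pos v = max 0 (l v)" for v
  define neg where "neg v = max 0 (- l v)" for v
  have pn: "pos v - neg v = l v" "0 \<le> pos v" "0 \<le> neg v" for v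
    by (auto simp: pos_def neg_def)
  define m where "m = sum neg C"
  define q where "q = (\<Sum>v\<in>C. neg v *\<^sub>R v)"
  have m': "m = sum pos C"
  proof -
    have "sum pos C - sum neg C = 0" using l pn by (simp add: sum_subtractf[symmetric])
    then show ?thesis by (simp add: m_def)
  qed
  have z: "z = (\<Sum>v\<in>C. pos v *\<^sub>R v) - q"
    using l pn by (simp add: q_def sum_subtractf[symmetric] scaleR_diff_left[symmetric])
  have mem: "((\<Sum>v\<in>C. f v *\<^sub>R v), sum f C) \<in> cone_over K" if "\<And>v. v \<in> C \<Longrightarrow> 0 \<le> f v" for f
    using C Kb CK that by (intro cone_over_sum) (auto simp: cone_over_iff)
  have "(z, m) \<in> cone_over (pointwise_diff K K)"
  proof -
    have "((\<Sum>v\<in>C. pos v *\<^sub>R v), m) \<in> cone_over K" "(q, m) \<in> cone_over K"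
      using mem[of pos] mem[of neg] pn by (simp_all add: m' q_def) (simp add: m'[symmetric] m_def)
    then obtain a b where "a \<in> K" "b \<in> K" "(\<Sum>v\<in>C. pos v *\<^sub>R v) = m *\<^sub>R a" "q = m *\<^sub>R b" "0 \<le> m"
      by (auto simp: cone_over_iff)
    then have "z = m *\<^sub>R (a - b)" "a - b \<in> pointwise_diff K K" "0 \<le> m"
      unfolding pointwise_diff_def using z by (auto simp: scaleR_diff_right)
    then show ?thesis by (auto simp: cone_over_iff)
  qed
  then have rm: "diff_gauge K z \<le> m" using gauge_le_iff[OF Kb(4-6)] by blast
  have in_cone: "(y - q, 1 - m) \<in> cone_over K" if "y \<in> overlap K z" for y
  proof -
    have y: "y \<in> K" "y + z \<in> K" using that by (auto simp: overlap_def)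
    obtain u' where u': "\<forall>v\<in>C. 0 \<le> u' v" "sum u' C = 1" "(\<Sum>v\<in>C. u' v *\<^sub>R v) = y"
      using coords[OF y(1)] by blast
    obtain w' where w': "\<forall>v\<in>C. 0 \<le> w' v" "sum w' C = 1" "(\<Sum>v\<in>C. w' v *\<^sub>R v) = y + z"
      using coords[OF y(2)] by blast
    have "w' v - u' v - l v = 0" if "v \<in> C" for v
      by (rule uniq[OF _ _ that])
        (use u' w' l in \<open>simp_all add: sum_subtractf scaleR_diff_left\<close>)
    then have "0 \<le> u' v - neg v" if "v \<in> C" for v
      using that u' w' by (force simp: neg_def max_def)
    from mem[of "\<lambda>v. u' v - neg v", OF this] show ?thesis
      using u' by (simp add: sum_subtractf scaleR_diff_left q_def m_def)
  qed
  have m1: "m \<le> 1" using in_cone False by (auto simp: cone_over_iff)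
  have sub: "overlap K z \<subseteq> (\<lambda>k. (1 - m) *\<^sub>R k + q) ` K"
  proof
    fix y assume "y \<in> overlap K z"
    from in_cone[OF this] obtain k where "k \<in> K" "y - q = (1 - m) *\<^sub>R k" by (auto simp: cone_over_iff)
    then show "y \<in> (\<lambda>k. (1 - m) *\<^sub>R k + q) ` K" by (auto simp: image_iff diff_eq_eq)
  qed
  have "compact ((\<lambda>k. (1 - m) *\<^sub>R k + q) ` K)"
    using Kb by (intro compact_continuous_image) (auto intro!: continuous_intros)
  then have "measure lebesgue (overlap K z) \<le> measure lebesgue ((\<lambda>k. (1 - m) *\<^sub>R k + q) ` K)"
    using lmeasurable_compact compact_overlap[OF Kb(1)]
    by (intro measure_mono_fmeasurable[OF sub]) (auto simp: fmeasurableD)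
  also have "\<dots> = measure lebesgue K * (1 - m) ^ DIM('a)"
    using m1 by (simp add: measure_homothet mult.commute)
  also have "\<dots> \<le> measure lebesgue K * (max 0 (1 - diff_gauge K z)) ^ DIM('a)"
    using rm m1 by (intro mult_left_mono power_mono) auto
  finally show ?thesis .
qed

section \<open>Slicing the profile of the difference body into dilates\<close>

text \<open>The density whose integral over \<open>{r..1}\<close> is \<open>(1 - r) ^ n\<close>:
  mixing the indicators of the dilates \<open>s D\<close> with this weight produces the function
  \<open>(1 - R) ^ n\<close>, cut off at zero.\<close>

definition shell_weight :: "nat \<Rightarrow> real \<Rightarrow> ennreal" where
  "shell_weight n s = ennreal (real n * (1 - s) ^ (n - 1)) * indicator {0..1} s"

lemma shell_weight_measurable [measurable]: "shell_weight n \<in> borel_measurable borel"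
  unfolding shell_weight_def by measurable

lemma nn_integral_shell_weight_tail:
  assumes n: "0 < n" and r: "0 \<le> r"
  shows "(\<integral>\<^sup>+ s. shell_weight n s * indicator {r..} s \<partial>lborel) = ennreal ((max 0 (1 - r)) ^ n)"
proof (cases "r \<le> 1")
  case True
  have "((\<lambda>s. - ((1 - s) ^ n)) has_vector_derivative real n * (1 - s) ^ (n - 1)) (at s within {r..1})" for s :: real
    unfolding has_real_derivative_iff_has_vector_derivative[symmetric]
    by (rule derivative_eq_intros refl)+ simp
  from fundamental_theorem_of_calculus[OF True this]
  have "((\<lambda>s. real n * (1 - s) ^ (n - 1)) has_integral (1 - r) ^ n) {r..1}" using n by (simp add: zero_power)
  then have "(\<integral>\<^sup>+ s. ennreal (real n * (1 - s) ^ (n - 1)) * indicator {r..1} s \<partial>lborel) = ennreal ((1 - r) ^ n)"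
    by (intro nn_integral_has_integral_lebesgue') auto
  moreover have "shell_weight n s * indicator {r..} s = ennreal (real n * (1 - s) ^ (n - 1)) * indicator {r..1} s" for s
    using r by (auto simp: shell_weight_def indicator_def)
  ultimately show ?thesis using True by simp
next
  case False
  then have *: "shell_weight n s * indicator {r..} s = 0" for s
    by (auto simp: shell_weight_def indicator_def)
  show ?thesis unfolding * using False n by (simp add: zero_power)
qed

text \<open>The Beta integral \<open>n * Beta (n + 1) n = n! n! / (2 n)!\<close>, which is where the
  central binomial coefficient enters.\<close>

lemma nn_integral_shell_weight_power:
  assumes n: "0 < n"
  shows "(\<integral>\<^sup>+ s. shell_weight n s * ennreal (s ^ n) \<partial>lborel) = ennreal (1 / real ((2 * n) choose n))"
proof -
  have "((\<lambda>t. t powr (real n + 1 - 1) * (1 - t) powr (real n - 1)) has_integral Beta (real n + 1) (real n)) {0..1}"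
    using n by (intro has_integral_Beta_real) auto
  then have "((\<lambda>t. real n * (t powr (real n + 1 - 1) * (1 - t) powr (real n - 1))) has_integral real n * Beta (real n + 1) (real n)) {0..1}"
    by (rule has_integral_mult_right)
  then have "((\<lambda>t. real n * (1 - t) ^ (n - 1) * t ^ n) has_integral real n * Beta (real n + 1) (real n)) {0..1}"
  proof (rule has_integral_spike_finite[of "{0, 1}", rotated 2])
    fix t :: real assume "t \<in> {0..1} - {0, 1}"
    then have t: "0 < t" "t < 1" by auto
    have "(1 - t) powr (real n - 1) = (1 - t) ^ (n - 1)"
      using t n by (simp add: powr_realpow[symmetric] of_nat_diff)
    then show "real n * (1 - t) ^ (n - 1) * t ^ n = real n * (t powr (real n + 1 - 1) * (1 - t) powr (real n - 1))"
      using t by (simp add: powr_realpow)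
  qed simp
  moreover have "real n * Beta (real n + 1) (real n) = 1 / real ((2 * n) choose n)"
  proof -
    obtain m where m: "n = Suc m" using n by (cases n) auto
    have "Beta (real n + 1) (real n) = fact n * fact m / fact (2 * n)"
      using Gamma_fact[of n, where 'a = real] Gamma_fact[of m, where 'a = real] Gamma_fact[of "2 * n", where 'a = real]
      by (simp add: Beta_def m add_ac mult_ac)
    moreover have "real n * fact m = fact n" by (simp add: m)
    moreover have "real ((2 * n) choose n) = fact (2 * n) / (fact n * fact n)"
      by (subst binomial_fact) (auto simp: mult_2)
    ultimately have "real n * Beta (real n + 1) (real n) = fact n * (real n * fact m) / fact (2 * n)"
      and "real ((2 * n) choose n) = fact (2 * n) / (fact n * fact n)" by simp_all
    then show ?thesis using \<open>real n * fact m = fact n\<close> by simp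
  qed
  ultimately have "((\<lambda>t. real n * (1 - t) ^ (n - 1) * t ^ n) has_integral 1 / real ((2 * n) choose n)) {0..1}"
    by simp
  then have "(\<integral>\<^sup>+ s. ennreal (real n * (1 - s) ^ (n - 1) * s ^ n) * indicator {0..1} s \<partial>lborel) = ennreal (1 / real ((2 * n) choose n))"
    by (intro nn_integral_has_integral_lebesgue') auto
  moreover have "shell_weight n s * ennreal (s ^ n) = ennreal (real n * (1 - s) ^ (n - 1) * s ^ n) * indicator {0..1} s" for s
    by (auto simp: shell_weight_def indicator_def ennreal_mult)
  ultimately show ?thesis by simp
qed

text \<open>Tonelli's theorem is applied to the product of the Borel measures, so a Lebesgue
  measurable density is replaced by a Borel one. Only the measure and the integrals of the
  replacement are ever used, since it need not inherit radial monotonicity.\<close>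

lemma lebesgue_borel_representative:
  fixes f :: "'a::euclidean_space \<Rightarrow> ennreal"
  assumes "f \<in> borel_measurable lebesgue"
  obtains g where "g \<in> borel_measurable borel" "density lebesgue f = density lebesgue g"
    "\<And>G. (\<integral>\<^sup>+ x. f x * G x \<partial>lebesgue) = (\<integral>\<^sup>+ x. g x * G x \<partial>lborel)"
proof -
  obtain g where g: "g \<in> borel_measurable lborel" "AE x in lborel. f x = g x"
    using completion_ex_borel_measurable[OF assms] by blast
  then have ae: "AE x in lebesgue. f x = g x" by (auto intro: AE_completion)
  show ?thesis
  proof
    show "g \<in> borel_measurable borel" using g by simp
    show "density lebesgue f = density lebesgue g"
      using assms g ae by (intro density_cong) (auto intro: measurable_completion)
    fix G
    have "(\<integral>\<^sup>+ x. f x * G x \<partial>lebesgue) = (\<integral>\<^sup>+ x. g x * G x \<partial>lebesgue)"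
      using ae by (intro nn_integral_cong_AE) auto
    then show "(\<integral>\<^sup>+ x. f x * G x \<partial>lebesgue) = (\<integral>\<^sup>+ x. g x * G x \<partial>lborel)"
      by (simp add: nn_integral_completion)
  qed
qed

lemma emeasure_density_lebesgue_borel:
  fixes g :: "'a::euclidean_space \<Rightarrow> ennreal"
  assumes "g \<in> borel_measurable borel" "A \<in> sets borel"
  shows "emeasure (density lebesgue g) A = (\<integral>\<^sup>+ x. g x * indicator A x \<partial>lborel)"
proof -
  have "g \<in> borel_measurable lebesgue" "A \<in> sets lebesgue"
    using assms by (auto intro: measurable_completion sets_completionI_sets)
  then show ?thesis by (simp add: emeasure_density nn_integral_completion del: sets_completion)
qed

text \<open>The point reflection \<open>y \<mapsto> - y - z\<close> maps the overlap of
  \<open>K\<close> onto that of \<open>- K\<close> for the same translation.\<close>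

lemma emeasure_overlap_uminus:
  fixes K :: "'a::euclidean_space set"
  shows "emeasure lebesgue (overlap (uminus ` K) z) = emeasure lebesgue (overlap K z)"
proof -
  have "overlap (uminus ` K) z = (\<lambda>y. (-1) *\<^sub>R y + (- z)) ` overlap K z"
  proof (intro set_eqI iffI)
    fix x assume "x \<in> overlap (uminus ` K) z"
    then obtain a b where "a \<in> K" "b \<in> K" "x = - a" "x + z = - b" unfolding overlap_def by blast
    then have "- x \<in> K" "- (x + z) \<in> K" by (simp_all only: minus_minus)
    then have "- (x + z) \<in> overlap K z" by (simp add: overlap_def)
    then show "x \<in> (\<lambda>y. (-1) *\<^sub>R y + (- z)) ` overlap K z"
      by (rule rev_image_eqI) simp
  next
    fix x assume "x \<in> (\<lambda>y. (-1) *\<^sub>R y + (- z)) ` overlap K z"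
    then obtain y where y: "y \<in> K" "y + z \<in> K" "x = - y - z" by (auto simp: overlap_def)
    have "x = - (y + z)" "x + z = - y" using y by simp_all
    then show "x \<in> overlap (uminus ` K) z" using y(1,2) unfolding overlap_def by blast
  qed
  then show ?thesis using emeasure_lebesgue_affine[of "-1" "- z" "overlap K z"] by simp
qed

text \<open>Exchanging the two integrations: a fixed \<open>z\<close> is counted once for every
  \<open>y \<in> K\<close> with \<open>y + z \<in> K\<close>.\<close>

lemma translated_average_eq:
  fixes K :: "'a::euclidean_space set"
  assumes K: "compact K" and f: "f \<in> borel_measurable lebesgue"
  shows "translated_average (density lebesgue f) K =
    1 / emeasure lebesgue K * (\<integral>\<^sup>+ z. f z * emeasure lebesgue (overlap K z) \<partial>lebesgue)"
proof -
  obtain g where g [measurable]: "g \<in> borel_measurable borel" and d: "density lebesgue f = density lebesgue g"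
    and fg: "\<And>G. (\<integral>\<^sup>+ x. f x * G x \<partial>lebesgue) = (\<integral>\<^sup>+ x. g x * G x \<partial>lborel)"
    by (rule lebesgue_borel_representative[OF f]) (rule that)
  have [measurable]: "K \<in> sets borel" using K by (simp add: borel_compact)
  have m: "emeasure (density lebesgue g) ((\<lambda>x. - y + x) ` K) = (\<integral>\<^sup>+ z. g z * indicator K (y + z) \<partial>lborel)" for y
  proof -
    have "(\<lambda>x. - y + x) ` K \<in> sets borel" using K by (intro borel_compact compact_translation)
    moreover have "z \<in> (\<lambda>x. - y + x) ` K \<longleftrightarrow> y + z \<in> K" for z
      by (auto simp: image_iff intro!: bexI[of _ "y + z"])
    then have "indicator ((\<lambda>x. - y + x) ` K) z = (indicator K (y + z) :: ennreal)" for z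
      by (simp only: indicator_def)
    ultimately show ?thesis using emeasure_density_lebesgue_borel[OF g] by simp
  qed
  have e: "emeasure lebesgue (overlap K z) = (\<integral>\<^sup>+ y. indicator K y * indicator K (y + z) \<partial>lborel)" for z
  proof -
    have "overlap K z \<in> sets borel" using K by (intro borel_compact compact_overlap)
    then have "emeasure lebesgue (overlap K z) = (\<integral>\<^sup>+ y. indicator (overlap K z) y \<partial>lborel)" by simp
    also have "\<dots> = (\<integral>\<^sup>+ y. indicator K y * indicator K (y + z) \<partial>lborel)"
      by (intro nn_integral_cong) (auto simp: overlap_def indicator_def)
    finally show ?thesis .
  qed
  have "(\<integral>\<^sup>+ y. emeasure (density lebesgue g) ((\<lambda>x. - y + x) ` K) * indicator K y \<partial>lebesgue)
      = (\<integral>\<^sup>+ y. (\<integral>\<^sup>+ z. g z * indicator K (y + z) \<partial>lborel) * indicator K y \<partial>lborel)"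
    by (simp only: m nn_integral_completion)
  also have "\<dots> = (\<integral>\<^sup>+ y. (\<integral>\<^sup>+ z. g z * (indicator K y * indicator K (y + z)) \<partial>lborel) \<partial>lborel)"
    by (subst nn_integral_multc[symmetric]) (auto simp: mult_ac)
  also have "\<dots> = (\<integral>\<^sup>+ z. (\<integral>\<^sup>+ y. g z * (indicator K y * indicator K (y + z)) \<partial>lborel) \<partial>lborel)"
    by (rule lborel_pair.Fubini') simp
  also have "\<dots> = (\<integral>\<^sup>+ z. g z * emeasure lebesgue (overlap K z) \<partial>lborel)"
    unfolding e by (subst nn_integral_cmult) auto
  finally show ?thesis by (simp only: translated_average_def d fg)
qed

lemma translated_average_uminus:
  fixes K :: "'a::euclidean_space set"
  assumes K: "compact K" and f: "f \<in> borel_measurable lebesgue"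
  shows "translated_average (density lebesgue f) (uminus ` K) = translated_average (density lebesgue f) K"
proof -
  have "emeasure lebesgue (uminus ` K) = emeasure lebesgue K"
    using emeasure_lebesgue_affine[of "-1" 0 K] by simp
  moreover have "compact (uminus ` K)" using compact_negations[OF K] by simp
  ultimately show ?thesis using K f by (simp add: translated_average_eq emeasure_overlap_uminus)
qed

text \<open>Describing the dilates as sublevel sets of the gauge makes membership in them jointly
  measurable in the scale and the point. The factor \<open>shell_weight n s\<close> removes negative
  \<open>s\<close>, for which the description fails.\<close>

lemma shell_weight_emeasure_dilate:
  fixes D :: "'a::euclidean_space set"
  assumes D: "compact D" "convex D" "0 \<in> interior D" and g: "g \<in> borel_measurable borel"
  shows "shell_weight n s * emeasure (density lebesgue g) ((\<lambda>x. s *\<^sub>R x) ` D) =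
    shell_weight n s * (\<integral>\<^sup>+ z. g z * indicator {..s} (gauge_fn D z) \<partial>lborel)"
proof (cases "0 \<le> s")
  case True
  have "(\<lambda>x. s *\<^sub>R x) ` D \<in> sets borel" using D by (intro borel_compact compact_scaling)
  moreover have "(indicator {..s} (gauge_fn D z) :: ennreal) = indicator ((\<lambda>x. s *\<^sub>R x) ` D) z" for z
    using gauge_le_iff_image[OF D True, of z] by (simp add: indicator_def)
  ultimately show ?thesis by (simp add: emeasure_density_lebesgue_borel g)
qed (simp add: shell_weight_def)

lemma measurable_shell_weight_emeasure_dilate:
  fixes D :: "'a::euclidean_space set"
  assumes D: "compact D" "convex D" "0 \<in> interior D" and f: "f \<in> borel_measurable lebesgue"
  shows "(\<lambda>s. shell_weight n s * emeasure (density lebesgue f) ((\<lambda>x. s *\<^sub>R x) ` D)) \<in> borel_measurable lborel"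
proof -
  obtain g where g: "g \<in> borel_measurable borel" and d: "density lebesgue f = density lebesgue g"
    by (rule lebesgue_borel_representative[OF f]) (rule that)
  have "gauge_fn D \<in> borel_measurable borel"
    using continuous_gauge[OF D] by (rule borel_measurable_continuous_onI)
  then show ?thesis
    unfolding d shell_weight_emeasure_dilate[OF D g] using g by (simp add: indicator_def)
qed

text \<open>The value \<open>(1 - R z) ^ n\<close> is the total weight of the scales \<open>s \<ge>
  R z\<close>, that is, of those with \<open>z \<in> s D\<close>; then integrate over
  \<open>z\<close> first.\<close>

lemma layer_cake_gauge:
  fixes D :: "'a::euclidean_space set"
  assumes D: "compact D" "convex D" "0 \<in> interior D" and f: "f \<in> borel_measurable lebesgue"
  shows "(\<integral>\<^sup>+ z. f z * ennreal ((max 0 (1 - gauge_fn D z)) ^ DIM('a)) \<partial>lebesgue) =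
    (\<integral>\<^sup>+ s. shell_weight DIM('a) s * emeasure (density lebesgue f) ((\<lambda>x. s *\<^sub>R x) ` D) \<partial>lborel)"
proof -
  let ?w = "shell_weight DIM('a)"
  obtain g where g [measurable]: "g \<in> borel_measurable borel" and d: "density lebesgue f = density lebesgue g"
    and fg: "\<And>G. (\<integral>\<^sup>+ x. f x * G x \<partial>lebesgue) = (\<integral>\<^sup>+ x. g x * G x \<partial>lborel)"
    by (rule lebesgue_borel_representative[OF f]) (rule that)
  have R [measurable]: "gauge_fn D \<in> borel_measurable borel"
    using continuous_gauge[OF D] by (rule borel_measurable_continuous_onI)
  have "(\<integral>\<^sup>+ z. f z * ennreal ((max 0 (1 - gauge_fn D z)) ^ DIM('a)) \<partial>lebesgue) =
    (\<integral>\<^sup>+ z. g z * (\<integral>\<^sup>+ s. ?w s * indicator {gauge_fn D z..} s \<partial>lborel) \<partial>lborel)"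
    unfolding fg by (simp add: nn_integral_shell_weight_tail gauge_nonneg[OF D])
  also have "\<dots> = (\<integral>\<^sup>+ z. (\<integral>\<^sup>+ s. g z * (?w s * indicator {..s} (gauge_fn D z)) \<partial>lborel) \<partial>lborel)"
    by (subst nn_integral_cmult[symmetric]) (auto simp: indicator_def intro!: nn_integral_cong)
  also have "\<dots> = (\<integral>\<^sup>+ s. (\<integral>\<^sup>+ z. g z * (?w s * indicator {..s} (gauge_fn D z)) \<partial>lborel) \<partial>lborel)"
    by (rule lborel_pair.Fubini'[symmetric]) (simp add: indicator_def)
  also have "\<dots> = (\<integral>\<^sup>+ s. ?w s * emeasure (density lebesgue f) ((\<lambda>x. s *\<^sub>R x) ` D) \<partial>lborel)"
    unfolding d shell_weight_emeasure_dilate[OF D g]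
    by (subst nn_integral_cmult[symmetric]) (auto simp: mult_ac)
  finally show ?thesis .
qed

lemma nn_integral_lebesgue_scale:
  fixes f :: "'a::euclidean_space \<Rightarrow> ennreal"
  assumes f: "f \<in> borel_measurable lebesgue" and c: "c \<noteq> 0"
  shows "(\<integral>\<^sup>+ x. f x \<partial>lebesgue) = ennreal (\<bar>c\<bar> ^ DIM('a)) * (\<integral>\<^sup>+ x. f (c *\<^sub>R x) \<partial>lebesgue)"
proof -
  have T: "(\<lambda>x::'a. 0 + (\<Sum>j\<in>Basis. (c * (x \<bullet> j)) *\<^sub>R j)) = (*\<^sub>R) c"
    unfolding scaleR_scaleR[symmetric] scaleR_sum_right[symmetric] by (auto simp: euclidean_representation)
  have leb: "(lebesgue :: 'a measure) = density (distr lebesgue lebesgue ((*\<^sub>R) c)) (\<lambda>_. ennreal (\<bar>c\<bar> ^ DIM('a)))"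
    using lebesgue_affine_euclidean[of "\<lambda>_. c" "0::'a"] c unfolding T by simp
  have "(\<integral>\<^sup>+ x. f x \<partial>lebesgue) = (\<integral>\<^sup>+ x. f x \<partial>density (distr lebesgue lebesgue ((*\<^sub>R) c)) (\<lambda>_. ennreal (\<bar>c\<bar> ^ DIM('a))))"
    by (subst leb) (rule refl)
  also have "\<dots> = (\<integral>\<^sup>+ x. ennreal (\<bar>c\<bar> ^ DIM('a)) * f x \<partial>distr lebesgue lebesgue ((*\<^sub>R) c))"
    using f by (intro nn_integral_density) auto
  also have "\<dots> = (\<integral>\<^sup>+ x. ennreal (\<bar>c\<bar> ^ DIM('a)) * f (c *\<^sub>R x) \<partial>lebesgue)"
    using f by (subst nn_integral_distr) (auto intro: lebesgue_measurable_scaling)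
  also have "\<dots> = ennreal (\<bar>c\<bar> ^ DIM('a)) * (\<integral>\<^sup>+ x. f (c *\<^sub>R x) \<partial>lebesgue)"
    by (intro nn_integral_cmult measurable_compose[OF lebesgue_measurable_scaling f])
  finally show ?thesis .
qed

lemma emeasure_density_dilate:
  fixes D :: "'a::euclidean_space set"
  assumes D: "D \<in> sets lebesgue" "(\<lambda>x. s *\<^sub>R x) ` D \<in> sets lebesgue"
    and f: "f \<in> borel_measurable lebesgue" and s: "0 < s"
  shows "emeasure (density lebesgue f) ((\<lambda>x. s *\<^sub>R x) ` D) =
    ennreal (s ^ DIM('a)) * (\<integral>\<^sup>+ x. f (s *\<^sub>R x) * indicator D x \<partial>lebesgue)"
proof -
  have "emeasure (density lebesgue f) ((\<lambda>x. s *\<^sub>R x) ` D) = (\<integral>\<^sup>+ x. f x * indicator ((\<lambda>x. s *\<^sub>R x) ` D) x \<partial>lebesgue)"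
    using D f by (intro emeasure_density)
  also have "\<dots> = ennreal (\<bar>s\<bar> ^ DIM('a)) *
      (\<integral>\<^sup>+ x. f (s *\<^sub>R x) * indicator ((\<lambda>x. s *\<^sub>R x) ` D) (s *\<^sub>R x) \<partial>lebesgue)"
    using D f s by (intro nn_integral_lebesgue_scale) (auto intro: borel_measurable_times_ennreal simp del: sets_completion)
  also have "(\<lambda>x. f (s *\<^sub>R x) * indicator ((\<lambda>x. s *\<^sub>R x) ` D) (s *\<^sub>R x)) = (\<lambda>x. f (s *\<^sub>R x) * indicator D x)"
    using s by (auto simp: indicator_def fun_eq_iff image_iff)
  finally show ?thesis using s by simp
qed

section \<open>Radially decreasing densities\<close>

text \<open>After substituting \<open>s x\<close> for \<open>x\<close>, the density on the dilate is
  pointwise at least the original one. At \<open>s = 0\<close> the left-hand side vanishes since the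
  dimension is positive.\<close>

lemma emeasure_dilate_ge:
  fixes D :: "'a::euclidean_space set" and \<phi> :: "'a \<Rightarrow> real"
  assumes D: "compact D" and \<phi>: "\<phi> \<in> borel_measurable lebesgue" "radially_decreasing \<phi>"
    and s: "0 \<le> s" "s \<le> 1"
  shows "ennreal (s ^ DIM('a)) * emeasure (density lebesgue (\<lambda>x. ennreal (\<phi> x))) D
    \<le> emeasure (density lebesgue (\<lambda>x. ennreal (\<phi> x))) ((\<lambda>x. s *\<^sub>R x) ` D)"
proof (cases "s = 0")
  case True
  then show ?thesis by (simp add: zero_power)
next
  case False
  have m: "(\<lambda>x. ennreal (\<phi> x)) \<in> borel_measurable lebesgue" using \<phi>(1) by measurable
  have sets: "D \<in> sets lebesgue" "(\<lambda>x. s *\<^sub>R x) ` D \<in> sets lebesgue"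
    using D compact_scaling lmeasurable_compact fmeasurableD by blast+
  have "emeasure (density lebesgue (\<lambda>x. ennreal (\<phi> x))) D = (\<integral>\<^sup>+ x. ennreal (\<phi> x) * indicator D x \<partial>lebesgue)"
    using m sets by (intro emeasure_density)
  also have "\<dots> \<le> (\<integral>\<^sup>+ x. ennreal (\<phi> (s *\<^sub>R x)) * indicator D x \<partial>lebesgue)"
    using \<phi>(2) s by (intro nn_integral_mono mult_right_mono ennreal_leI) (auto simp: radially_decreasing_def)
  finally show ?thesis
    using emeasure_density_dilate[OF sets m] s False by (simp add: mult_left_mono)
qed

abbreviation radial_profile :: "'a::euclidean_space set \<Rightarrow> 'a \<Rightarrow> real" where
  "radial_profile D z \<equiv> (max 0 (1 - gauge_fn D z)) ^ DIM('a)"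

lemma nn_integral_shell_weight_homogeneous:
  assumes "0 < n"
  shows "of_nat ((2 * n) choose n) * (\<integral>\<^sup>+ s. shell_weight n s * (ennreal (s ^ n) * A) \<partial>lborel) = A"
proof -
  have "(\<integral>\<^sup>+ s. shell_weight n s * (ennreal (s ^ n) * A) \<partial>lborel) = ennreal (1 / real ((2 * n) choose n)) * A"
    unfolding mult.assoc[symmetric] nn_integral_shell_weight_power[OF assms, symmetric]
    by (intro nn_integral_multc) measurable
  moreover have "of_nat ((2 * n) choose n) * ennreal (1 / real ((2 * n) choose n)) = 1"
  proof -
    have "real ((2 * n) choose n) \<noteq> 0" by simp
    then show ?thesis
      unfolding ennreal_of_nat_eq_real_of_nat by (subst ennreal_mult[symmetric]) auto
  qed
  ultimately show ?thesis by (simp add: mult.assoc[symmetric])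
qed

text \<open>Combine the layer-cake formula with \<open>emeasure_dilate_ge\<close> scale by scale; a
  measure that is exactly homogeneous of degree \<open>n\<close> on dilates would give
  equality.\<close>

lemma emeasure_le_profile_integral:
  fixes D :: "'a::euclidean_space set" and \<phi> :: "'a \<Rightarrow> real"
  assumes D: "compact D" "convex D" "0 \<in> interior D"
    and \<phi>: "\<phi> \<in> borel_measurable lebesgue" "radially_decreasing \<phi>"
  shows "emeasure (density lebesgue (\<lambda>x. ennreal (\<phi> x))) D \<le>
    of_nat ((2 * DIM('a)) choose DIM('a)) * (\<integral>\<^sup>+ z. ennreal (\<phi> z) * ennreal (radial_profile D z) \<partial>lebesgue)"
proof -
  let ?\<mu> = "density lebesgue (\<lambda>x. ennreal (\<phi> x))" and ?w = "shell_weight DIM('a)"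
  have m: "(\<lambda>x. ennreal (\<phi> x)) \<in> borel_measurable lebesgue" using \<phi>(1) by measurable
  have "emeasure ?\<mu> D = of_nat ((2 * DIM('a)) choose DIM('a)) *
      (\<integral>\<^sup>+ s. ?w s * (ennreal (s ^ DIM('a)) * emeasure ?\<mu> D) \<partial>lborel)"
    by (rule nn_integral_shell_weight_homogeneous[symmetric]) simp
  also have "\<dots> \<le> of_nat ((2 * DIM('a)) choose DIM('a)) *
      (\<integral>\<^sup>+ s. ?w s * emeasure ?\<mu> ((\<lambda>x. s *\<^sub>R x) ` D) \<partial>lborel)"
  proof (rule mult_left_mono, rule nn_integral_mono)
    fix s :: real
    show "?w s * (ennreal (s ^ DIM('a)) * emeasure ?\<mu> D) \<le> ?w s * emeasure ?\<mu> ((\<lambda>x. s *\<^sub>R x) ` D)"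
    proof (cases "s \<in> {0..1}")
      case True
      then show ?thesis using emeasure_dilate_ge[OF D(1) \<phi>] by (intro mult_left_mono) auto
    qed (simp add: shell_weight_def)
  qed simp
  finally show ?thesis by (simp only: layer_cake_gauge[OF D m])
qed

text \<open>For a multiple of the volume the measure of the dilates is homogeneous, so no scale
  loses anything.\<close>

lemma emeasure_eq_profile_integral_if_constant:
  fixes D :: "'a::euclidean_space set" and \<phi> :: "'a \<Rightarrow> real"
  assumes D: "compact D" "convex D" "0 \<in> interior D"
    and \<phi>: "\<phi> \<in> borel_measurable lebesgue"
    and c: "constant_multiple_of_lebesgue_on (density lebesgue (\<lambda>x. ennreal (\<phi> x))) D"
  shows "emeasure (density lebesgue (\<lambda>x. ennreal (\<phi> x))) D =
    of_nat ((2 * DIM('a)) choose DIM('a)) * (\<integral>\<^sup>+ z. ennreal (\<phi> z) * ennreal (radial_profile D z) \<partial>lebesgue)"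
proof -
  let ?\<mu> = "density lebesgue (\<lambda>x. ennreal (\<phi> x))" and ?w = "shell_weight DIM('a)"
  have m: "(\<lambda>x. ennreal (\<phi> x)) \<in> borel_measurable lebesgue" using \<phi>(1) by measurable
  obtain c where c: "\<And>M. M \<in> sets lebesgue \<Longrightarrow> M \<subseteq> D \<Longrightarrow> emeasure ?\<mu> M = ennreal c * emeasure lebesgue M"
    using c unfolding constant_multiple_of_lebesgue_on_def by blast
  have sets: "(\<lambda>x. s *\<^sub>R x) ` D \<in> sets lebesgue" for s
    using D(1) compact_scaling lmeasurable_compact fmeasurableD by blast
  have "emeasure ?\<mu> ((\<lambda>x. s *\<^sub>R x) ` D) = ennreal (s ^ DIM('a)) * emeasure ?\<mu> D" if s: "0 \<le> s" "s \<le> 1" for s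
  proof -
    have "(\<lambda>x. s *\<^sub>R x) ` D \<subseteq> D"
    proof clarify
      fix x assume "x \<in> D"
      moreover have "0 \<in> D" using D interior_subset by blast
      ultimately show "s *\<^sub>R x \<in> D" using convexD[OF D(2), of x 0 s "1 - s"] s by simp
    qed
    then have "emeasure ?\<mu> ((\<lambda>x. s *\<^sub>R x) ` D) = ennreal c * emeasure lebesgue ((\<lambda>x. s *\<^sub>R x) ` D)"
      using c sets by blast
    also have "emeasure lebesgue ((\<lambda>x. s *\<^sub>R x) ` D) = ennreal (s ^ DIM('a)) * emeasure lebesgue D"
      using emeasure_lebesgue_affine[of s 0 D] s by simp
    finally show ?thesis using c[of D] sets[of 1] by (simp add: mult_ac)
  qed
  then have "?w s * emeasure ?\<mu> ((\<lambda>x. s *\<^sub>R x) ` D) = ?w s * (ennreal (s ^ DIM('a)) * emeasure ?\<mu> D)" for s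
    by (cases "s \<in> {0..1}") (auto simp: shell_weight_def)
  then show ?thesis
    by (simp only: layer_cake_gauge[OF D m] nn_integral_shell_weight_homogeneous DIM_positive)
qed

lemma AE_eq_if_nn_integral_eq:
  assumes "f \<in> borel_measurable M" "g \<in> borel_measurable M"
    and "\<And>x. f x \<le> g x" "(\<integral>\<^sup>+ x. f x \<partial>M) = (\<integral>\<^sup>+ x. g x \<partial>M)" "(\<integral>\<^sup>+ x. f x \<partial>M) \<noteq> \<infinity>"
  shows "AE x in M. f x = g x"
proof -
  have "AE x in M. g x \<le> f x"
  proof (rule ccontr)
    assume "\<not> ?thesis"
    from nn_integral_less[OF assms(1,2,5) _ this] show False using assms by simp
  qed
  then show ?thesis using assms(3) by (auto intro: antisym)
qed

lemma radially_decreasing_le_zero: "radially_decreasing \<phi> \<Longrightarrow> \<phi> x \<le> \<phi> 0"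
  unfolding radially_decreasing_def by (metis atLeastAtMost_iff order_refl scaleR_zero_left zero_le_one)

text \<open>Equality forces equality at almost every scale, so the mean of \<open>\<phi> (s
  x)\<close> over \<open>D\<close> has the value it has at scale one for scales \<open>s\<close>
  arbitrarily close to zero. Along such scales \<open>\<phi> (s x)\<close> tends to \<open>\<phi>
  0\<close>, and Fatou's lemma gives that the integral of \<open>\<phi>\<close> over
  \<open>D\<close> is at least that of its maximum \<open>\<phi> 0\<close>.\<close>

lemma AE_constant_if_profile_equality:
  fixes D :: "'a::euclidean_space set" and \<phi> :: "'a \<Rightarrow> real"
  assumes D: "compact D" "convex D" "0 \<in> interior D"
    and \<phi>: "\<phi> \<in> borel_measurable lebesgue" "radially_decreasing \<phi>" "isCont \<phi> 0"
    and eq: "emeasure (density lebesgue (\<lambda>x. ennreal (\<phi> x))) D =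
      of_nat ((2 * DIM('a)) choose DIM('a)) * (\<integral>\<^sup>+ z. ennreal (\<phi> z) * ennreal (radial_profile D z) \<partial>lebesgue)"
  shows "AE x in lebesgue. x \<in> D \<longrightarrow> ennreal (\<phi> x) = ennreal (\<phi> 0)"
proof -
  let ?n = "DIM('a)"
  let ?N = "of_nat ((2 * ?n) choose ?n) :: ennreal"
  define f where "f x = ennreal (\<phi> x)" for x
  let ?\<mu> = "density lebesgue f" and ?w = "shell_weight DIM('a)"
  have f: "f \<in> borel_measurable lebesgue" unfolding f_def using \<phi>(1) by measurable
  have sets: "(\<lambda>x. s *\<^sub>R x) ` D \<in> sets lebesgue" for s
    using D(1) compact_scaling lmeasurable_compact fmeasurableD by blast
  have Ds: "D \<in> sets lebesgue" using D(1) lmeasurable_compact fmeasurableD by blast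
  define A where "A = emeasure ?\<mu> D"
  have A: "A = (\<integral>\<^sup>+ x. f x * indicator D x \<partial>lebesgue)"
    unfolding A_def using f Ds by (rule emeasure_density)
  have f0: "f x \<le> f 0" for x
    unfolding f_def using radially_decreasing_le_zero[OF \<phi>(2)] by (rule ennreal_leI)
  have D_fin: "emeasure lebesgue D < \<infinity>"
    using D(1) lmeasurable_compact fmeasurableD2 by (metis infinity_ennreal_def top.not_eq_extremum)
  have const: "(\<integral>\<^sup>+ x. f 0 * indicator D x \<partial>lebesgue) = f 0 * emeasure lebesgue D"
    using Ds by (rule nn_integral_cmult_indicator)
  have A_fin: "A < \<infinity>"
  proof -
    have "A \<le> (\<integral>\<^sup>+ x. f 0 * indicator D x \<partial>lebesgue)"
      unfolding A using f0 by (intro nn_integral_mono mult_right_mono) auto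
    also have "\<dots> < \<infinity>" unfolding const using D_fin by (simp add: f_def ennreal_mult_less_top)
    finally show ?thesis .
  qed
  define G where "G s = (\<integral>\<^sup>+ x. f (s *\<^sub>R x) * indicator D x \<partial>lebesgue)" for s
  have dil: "emeasure ?\<mu> ((\<lambda>x. s *\<^sub>R x) ` D) = ennreal (s ^ ?n) * G s" if "0 < s" for s
    unfolding G_def using emeasure_density_dilate[OF Ds sets f that] .
  have NN: "?N \<noteq> 0" "?N \<noteq> \<infinity>" by (simp_all add: ennreal_of_nat_eq_real_of_nat)
  have "AE s in lborel. ?w s * (ennreal (s ^ ?n) * A) = ?w s * emeasure ?\<mu> ((\<lambda>x. s *\<^sub>R x) ` D)"
  proof (rule AE_eq_if_nn_integral_eq)
    have hom: "?N * (\<integral>\<^sup>+ s. ?w s * (ennreal (s ^ ?n) * A) \<partial>lborel) = A"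
      by (rule nn_integral_shell_weight_homogeneous) simp
    show "(\<lambda>s. ?w s * (ennreal (s ^ ?n) * A)) \<in> borel_measurable lborel" by measurable
    show "?w s * (ennreal (s ^ ?n) * A) \<le> ?w s * emeasure ?\<mu> ((\<lambda>x. s *\<^sub>R x) ` D)" for s
    proof (cases "s \<in> {0..1}")
      case True
      then show ?thesis using emeasure_dilate_ge[OF D(1) \<phi>(1,2)]
        unfolding A_def f_def by (intro mult_left_mono) auto
    qed (simp add: shell_weight_def)
    have "?N * (\<integral>\<^sup>+ s. ?w s * emeasure ?\<mu> ((\<lambda>x. s *\<^sub>R x) ` D) \<partial>lborel) = A"
      using eq unfolding layer_cake_gauge[OF D f, symmetric] by (simp add: A_def f_def[abs_def])
    with hom show "(\<integral>\<^sup>+ s. ?w s * (ennreal (s ^ ?n) * A) \<partial>lborel) =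
        (\<integral>\<^sup>+ s. ?w s * emeasure ?\<mu> ((\<lambda>x. s *\<^sub>R x) ` D) \<partial>lborel)"
      using NN ennreal_mult_cancel_left[of ?N] by auto
    show "(\<integral>\<^sup>+ s. ?w s * (ennreal (s ^ ?n) * A) \<partial>lborel) \<noteq> \<infinity>"
    proof
      assume "(\<integral>\<^sup>+ s. ?w s * (ennreal (s ^ ?n) * A) \<partial>lborel) = \<infinity>"
      then have "A = \<infinity>" using hom NN by (simp add: ennreal_mult_top)
      then show False using A_fin by simp
    qed
  qed (rule measurable_shell_weight_emeasure_dilate[OF D f])
  then have AE_G: "AE s in lborel. s \<in> {0<..<1} \<longrightarrow> G s = A"
  proof (rule AE_mp, intro AE_I2 impI)
    fix s :: real
    assume *: "?w s * (ennreal (s ^ ?n) * A) = ?w s * emeasure ?\<mu> ((\<lambda>x. s *\<^sub>R x) ` D)" and s: "s \<in> {0<..<1}"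
    have "?w s * ennreal (s ^ ?n) = ennreal (real ?n * (1 - s) ^ (?n - 1) * s ^ ?n)"
      using s by (simp add: shell_weight_def ennreal_mult)
    then have w: "?w s * ennreal (s ^ ?n) \<noteq> 0" "?w s * ennreal (s ^ ?n) \<noteq> \<infinity>" using s by auto
    have "?w s * ennreal (s ^ ?n) * A = ?w s * ennreal (s ^ ?n) * G s"
      using * s by (simp add: dil mult.assoc)
    then show "G s = A" using w by (metis ennreal_mult_cancel_left infinity_ennreal_def)
  qed
  \<comment> \<open>An interval at the origin has positive length, so it meets the set of good scales.\<close>
  have ex: "\<exists>s. 0 < s \<and> s < 1 / real (Suc k) \<and> G s = A" for k
  proof (rule ccontr)
    assume no: "\<not> ?thesis"
    have k: "1 / real (Suc k) \<le> 1" by simp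
    have "AE s in lborel. s \<notin> {0<..<1 / real (Suc k)}"
      using AE_G
    proof eventually_elim
      case (elim s)
      show ?case
      proof
        assume s: "s \<in> {0<..<1 / real (Suc k)}"
        then have "s < 1" using k by (meson greaterThanLessThan_iff less_le_trans)
        then show False using elim s no by auto
      qed
    qed
    moreover have "{0<..<1 / real (Suc k)} \<in> sets lborel" by simp
    ultimately have "{0<..<1 / real (Suc k)} \<in> null_sets lborel"
      using AE_iff_null_sets by blast
    then have "emeasure lborel {0<..<1 / real (Suc k)} = 0" by (rule null_setsD1)
    then show False by simp
  qed
  define t where "t k = (SOME s. 0 < s \<and> s < 1 / real (Suc k) \<and> G s = A)" for k
  have t: "0 < t k" "t k < 1 / real (Suc k)" "G (t k) = A" for k
    using someI_ex[OF ex[of k]] unfolding t_def by blast+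
  have t0: "t \<longlonglongrightarrow> 0"
  proof (rule tendsto_sandwich[of "\<lambda>_. 0" t _ "\<lambda>k. 1 / real (Suc k)"])
    show "(\<lambda>k. 1 / real (Suc k)) \<longlonglongrightarrow> 0" using LIMSEQ_inverse_real_of_nat by (simp add: inverse_eq_divide)
    show "\<forall>\<^sub>F k in sequentially. 0 \<le> t k" using t by (simp add: less_imp_le)
    show "\<forall>\<^sub>F k in sequentially. t k \<le> 1 / real (Suc k)" using t by (simp add: less_imp_le)
  qed simp
  have lim: "liminf (\<lambda>k. f (t k *\<^sub>R x) * indicator D x) = f 0 * indicator D x" for x
  proof (rule lim_imp_Liminf)
    have "(\<lambda>k. t k *\<^sub>R x) \<longlonglongrightarrow> 0 *\<^sub>R x" using t0 by (intro tendsto_intros)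
    then have "(\<lambda>k. \<phi> (t k *\<^sub>R x)) \<longlonglongrightarrow> \<phi> 0"
      using isCont_tendsto_compose[OF \<phi>(3), of "\<lambda>k. t k *\<^sub>R x"] by simp
    then have "(\<lambda>k. f (t k *\<^sub>R x)) \<longlonglongrightarrow> f 0" unfolding f_def by (rule tendsto_ennrealI)
    then show "(\<lambda>k. f (t k *\<^sub>R x) * indicator D x) \<longlonglongrightarrow> f 0 * indicator D x"
      by (cases "x \<in> D") auto
  qed simp
  have "f 0 * emeasure lebesgue D = (\<integral>\<^sup>+ x. liminf (\<lambda>k. f (t k *\<^sub>R x) * indicator D x) \<partial>lebesgue)"
    by (simp only: lim const)
  also have "\<dots> \<le> liminf (\<lambda>k. \<integral>\<^sup>+ x. f (t k *\<^sub>R x) * indicator D x \<partial>lebesgue)"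
  proof (rule nn_integral_liminf)
    fix k
    show "(\<lambda>x. f (t k *\<^sub>R x) * indicator D x) \<in> borel_measurable lebesgue"
      using measurable_compose[OF lebesgue_measurable_scaling f] Ds
      by (intro borel_measurable_times_ennreal borel_measurable_indicator)
  qed
  also have "\<dots> = A" using t(3) unfolding G_def by (simp add: Liminf_const)
  finally have ge: "f 0 * emeasure lebesgue D \<le> A" .
  have "AE x in lebesgue. f x * indicator D x = f 0 * indicator D x"
  proof (rule AE_eq_if_nn_integral_eq)
    show "(\<lambda>x. f x * indicator D x) \<in> borel_measurable lebesgue" "(\<lambda>x. f 0 * indicator D x) \<in> borel_measurable lebesgue"
      using f Ds by (auto intro!: borel_measurable_times_ennreal borel_measurable_indicator simp del: sets_completion)
    show "f x * indicator D x \<le> f 0 * indicator D x" for x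
      using f0 by (intro mult_right_mono) auto
    then have "A \<le> (\<integral>\<^sup>+ x. f 0 * indicator D x \<partial>lebesgue)" unfolding A by (rule nn_integral_mono)
    then show "(\<integral>\<^sup>+ x. f x * indicator D x \<partial>lebesgue) = (\<integral>\<^sup>+ x. f 0 * indicator D x \<partial>lebesgue)"
      using ge by (simp add: const A[symmetric])
    show "(\<integral>\<^sup>+ x. f x * indicator D x \<partial>lebesgue) \<noteq> \<infinity>" using A_fin unfolding A by simp
  qed
  then show ?thesis
    by (rule AE_mp) (auto intro!: AE_I2 simp: f_def indicator_def)
qed

lemma constant_multiple_if_AE_constant:
  fixes D :: "'a::euclidean_space set" and \<phi> :: "'a \<Rightarrow> real"
  assumes \<phi>: "\<phi> \<in> borel_measurable lebesgue"
    and ae: "AE x in lebesgue. x \<in> D \<longrightarrow> ennreal (\<phi> x) = ennreal c" and "0 \<le> c"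
  shows "constant_multiple_of_lebesgue_on (density lebesgue (\<lambda>x. ennreal (\<phi> x))) D"
  unfolding constant_multiple_of_lebesgue_on_def
proof (intro exI[of _ c] conjI ballI impI)
  fix M assume M: "M \<in> sets lebesgue" "M \<subseteq> D"
  have "emeasure (density lebesgue (\<lambda>x. ennreal (\<phi> x))) M = (\<integral>\<^sup>+ x. ennreal (\<phi> x) * indicator M x \<partial>lebesgue)"
    using \<phi> M by (intro emeasure_density) auto
  also have "\<dots> = (\<integral>\<^sup>+ x. ennreal c * indicator M x \<partial>lebesgue)"
  proof (rule nn_integral_cong_AE)
    show "AE x in lebesgue. ennreal (\<phi> x) * indicator M x = ennreal c * indicator M x"
      using ae by eventually_elim (use M(2) in \<open>auto simp: indicator_def\<close>)
  qed
  also have "\<dots> = ennreal c * emeasure lebesgue M" using M(1) by (rule nn_integral_cmult_indicator)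
  finally show "emeasure (density lebesgue (\<lambda>x. ennreal (\<phi> x))) M = ennreal c * emeasure lebesgue M" .
qed fact

section \<open>Comparing overlaps with the profile\<close>

definition overlap_ratio :: "'a::euclidean_space set \<Rightarrow> 'a \<Rightarrow> real" where
  "overlap_ratio K z = measure lebesgue (overlap K z) / measure lebesgue K"

lemma continuous_overlap_ratio:
  assumes "convex_body K" shows "continuous_on UNIV (overlap_ratio K)"
  unfolding overlap_ratio_def using emeasure_convex_body(1)[OF assms] convex_bodyD[OF assms]
  by (intro continuous_intros continuous_measure_overlap) auto

lemma overlap_ratio_nonneg: "0 \<le> overlap_ratio K z"
  by (simp add: overlap_ratio_def)

lemma overlap_ratio_ge:
  assumes "convex_body K" shows "radial_profile (pointwise_diff K K) z \<le> overlap_ratio K z"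
  using measure_overlap_ge[OF assms, of z] emeasure_convex_body(1)[OF assms]
  by (simp add: overlap_ratio_def field_simps)

lemma translated_average_overlap_ratio:
  assumes K: "convex_body K" and f: "f \<in> borel_measurable lebesgue"
  shows "translated_average (density lebesgue f) K = (\<integral>\<^sup>+ z. f z * ennreal (overlap_ratio K z) \<partial>lebesgue)"
proof -
  note Kb = convex_bodyD[OF K] and V = emeasure_convex_body[OF K]
  have "1 / emeasure lebesgue K = ennreal (1 / measure lebesgue K)"
    unfolding V(2) using V(1) by (simp add: divide_ennreal[symmetric])
  moreover have "emeasure lebesgue (overlap K z) = ennreal (measure lebesgue (overlap K z))" for z
    using lmeasurable_compact[OF compact_overlap[OF Kb(1)]] by (simp add: emeasure_eq_measure2)
  then have "f z * ennreal (overlap_ratio K z) = ennreal (1 / measure lebesgue K) * (f z * emeasure lebesgue (overlap K z))" for z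
  proof -
    have "ennreal (overlap_ratio K z) = ennreal (1 / measure lebesgue K) * ennreal (measure lebesgue (overlap K z))"
      using V(1) by (simp add: overlap_ratio_def ennreal_mult[symmetric])
    then show ?thesis by (simp only: \<open>\<And>z. emeasure lebesgue (overlap K z) = _\<close> mult.left_commute)
  qed
  moreover have "(\<lambda>z. f z * emeasure lebesgue (overlap K z)) \<in> borel_measurable lebesgue"
  proof -
    have "(\<lambda>z. measure lebesgue (overlap K z)) \<in> borel_measurable borel"
      using continuous_measure_overlap[OF Kb(1,2)] by (rule borel_measurable_continuous_onI)
    then have "(\<lambda>z. ennreal (measure lebesgue (overlap K z))) \<in> borel_measurable lebesgue"
      by (auto intro: measurable_completion)
    then show ?thesis using f \<open>\<And>z. emeasure lebesgue (overlap K z) = _\<close> by (simp add: borel_measurable_times_ennreal)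
  qed
  ultimately show ?thesis
    by (simp add: translated_average_eq[OF Kb(1) f] nn_integral_cmult)
qed

text \<open>The two integrands are ordered pointwise and have the same finite integral, so they
  agree almost everywhere. The constant can be cancelled on the difference body, and outside of it
  both functions vanish. Two continuous functions that agree almost everywhere are equal.\<close>

lemma profile_eq_overlap_ratio_if_integral_eq:
  fixes K :: "'a::euclidean_space set" and \<phi> :: "'a \<Rightarrow> real"
  assumes K: "convex_body K" and \<phi>: "\<phi> \<in> borel_measurable lebesgue"
    and ae: "AE x in lebesgue. x \<in> pointwise_diff K K \<longrightarrow> ennreal (\<phi> x) = ennreal c" and c: "0 < c"
    and eq: "(\<integral>\<^sup>+ z. ennreal (\<phi> z) * ennreal (radial_profile (pointwise_diff K K) z) \<partial>lebesgue) =
      (\<integral>\<^sup>+ z. ennreal (\<phi> z) * ennreal (overlap_ratio K z) \<partial>lebesgue)"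
    and fin: "(\<integral>\<^sup>+ z. ennreal (\<phi> z) * ennreal (radial_profile (pointwise_diff K K) z) \<partial>lebesgue) \<noteq> \<infinity>"
  shows "radial_profile (pointwise_diff K K) z = overlap_ratio K z"
proof -
  let ?D = "pointwise_diff K K"
  note Kb = convex_bodyD[OF K]
  have ch: "continuous_on UNIV (radial_profile ?D)"
    using continuous_gauge[OF Kb(4-6)] by (intro continuous_intros)
  note cr = continuous_overlap_ratio[OF K]
  have m: "(\<lambda>z. ennreal (\<phi> z) * ennreal (r z)) \<in> borel_measurable lebesgue" if "continuous_on UNIV r" for r
  proof -
    have "r \<in> borel_measurable lebesgue"
      using borel_measurable_continuous_onI[OF that] by (auto intro: measurable_completion)
    then show ?thesis using \<phi> by measurable
  qed
  have "AE z in lebesgue. ennreal (\<phi> z) * ennreal (radial_profile ?D z) = ennreal (\<phi> z) * ennreal (overlap_ratio K z)"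
    by (rule AE_eq_if_nn_integral_eq[OF m[OF ch] m[OF cr] _ eq fin])
      (intro mult_left_mono ennreal_leI overlap_ratio_ge[OF K] zero_le)
  with ae have "AE z in lebesgue. z \<in> {z. radial_profile ?D z = overlap_ratio K z}"
  proof eventually_elim
    case (elim z)
    show ?case
    proof (cases "z \<in> ?D")
      case True
      then have "ennreal c * ennreal (radial_profile ?D z) = ennreal c * ennreal (overlap_ratio K z)"
        using elim by simp
      then show ?thesis using c
        by (simp add: ennreal_mult_cancel_left overlap_ratio_nonneg)
    next
      case False
      then have "1 < gauge_fn ?D z" using gauge_le_1_iff[OF Kb(4-6)] by (meson not_le)
      then have "radial_profile ?D z = 0" by (simp add: zero_power)
      then show ?thesis using overlap_empty[OF False] by (simp add: overlap_ratio_def)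
    qed
  qed
  moreover have "closed {z. radial_profile ?D z = overlap_ratio K z}"
    by (rule closed_Collect_eq[OF ch cr])
  ultimately show ?thesis using mem_closed_if_AE_lebesgue by blast
qed

section \<open>The inequality and its equality case\<close>

theorem theorem1p1:
  fixes K :: "'a::euclidean_space set"
    and \<phi> :: "'a \<Rightarrow> real"
    and \<mu> :: "'a measure"
  assumes "convex_body K"
    and "\<phi> \<in> borel_measurable lebesgue"
    and "\<And>x. \<phi> x \<ge> 0"
    and "radially_decreasing \<phi>"
    and "\<mu> = density lebesgue (\<lambda>x. ennreal (\<phi> x))"
  shows "emeasure \<mu> (pointwise_diff K K) \<le>
           of_nat ((2 * DIM('a)) choose DIM('a)) *
             min (translated_average \<mu> K) (translated_average \<mu> (uminus ` K)) \<and>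
         (isCont \<phi> 0 \<and> emeasure \<mu> UNIV \<noteq> 0 \<longrightarrow>
           (emeasure \<mu> (pointwise_diff K K) =
              of_nat ((2 * DIM('a)) choose DIM('a)) *
                min (translated_average \<mu> K) (translated_average \<mu> (uminus ` K))
            \<longleftrightarrow>
            constant_multiple_of_lebesgue_on \<mu> (pointwise_diff K K) \<and>
            (int DIM('a)) simplex K))"
proof -
  let ?D = "pointwise_diff K K"
  let ?N = "of_nat ((2 * DIM('a)) choose DIM('a)) :: ennreal"
  note K = assms(1) and \<phi> = assms(2) and nonneg = assms(3) and rd = assms(4) and \<mu> = assms(5)
  note Kb = convex_bodyD[OF K]
  have f: "(\<lambda>x. ennreal (\<phi> x)) \<in> borel_measurable lebesgue" using \<phi> by measurable
  define T where "T = translated_average \<mu> K"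
  define J where "J = (\<integral>\<^sup>+ z. ennreal (\<phi> z) * ennreal (radial_profile ?D z) \<partial>lebesgue)"
  have T: "T = (\<integral>\<^sup>+ z. ennreal (\<phi> z) * ennreal (overlap_ratio K z) \<partial>lebesgue)"
    unfolding T_def \<mu> by (rule translated_average_overlap_ratio[OF K f])
  have min: "min (translated_average \<mu> K) (translated_average \<mu> (uminus ` K)) = T"
    unfolding T_def \<mu> using translated_average_uminus[OF Kb(1) f] by simp
  have AJ: "emeasure \<mu> ?D \<le> ?N * J"
    unfolding J_def \<mu> by (rule emeasure_le_profile_integral[OF Kb(4-6) \<phi> rd])
  have JT: "J \<le> T"
    unfolding J_def T by (intro nn_integral_mono mult_left_mono ennreal_leI overlap_ratio_ge[OF K] zero_le)
  have NN: "?N \<noteq> 0" "?N \<noteq> \<infinity>" by (simp_all add: ennreal_of_nat_eq_real_of_nat)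
  have NJT: "?N * J \<le> ?N * T" using JT by (rule mult_left_mono) simp
  have forward: "constant_multiple_of_lebesgue_on \<mu> ?D \<and> int DIM('a) simplex K"
    if eq: "emeasure \<mu> ?D = ?N * T" and cont: "isCont \<phi> 0" and nz: "emeasure \<mu> UNIV \<noteq> 0"
  proof -
    have NJ: "emeasure \<mu> ?D = ?N * J" using AJ NJT eq by (metis antisym)
    then have JeqT: "J = T" using eq NN by (metis ennreal_mult_cancel_left infinity_ennreal_def)
    have ae: "AE x in lebesgue. x \<in> ?D \<longrightarrow> ennreal (\<phi> x) = ennreal (\<phi> 0)"
      using NJ unfolding J_def \<mu> by (rule AE_constant_if_profile_equality[OF Kb(4-6) \<phi> rd cont])
    have const: "constant_multiple_of_lebesgue_on \<mu> ?D"
      unfolding \<mu> using \<phi> ae nonneg by (rule constant_multiple_if_AE_constant)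
    have pos: "0 < \<phi> 0"
    proof (rule ccontr)
      assume "\<not> 0 < \<phi> 0"
      then have "\<phi> x = 0" for x
        using radially_decreasing_le_zero[OF rd, of x] nonneg[of x] by linarith
      then have "emeasure \<mu> UNIV = 0" unfolding \<mu> using f by (subst emeasure_density) auto
      then show False using nz by simp
    qed
    have "emeasure \<mu> ?D < \<infinity>"
    proof -
      obtain c where "emeasure \<mu> ?D = ennreal c * emeasure lebesgue ?D"
        using const lmeasurable_compact[OF Kb(4)] fmeasurableD
        unfolding constant_multiple_of_lebesgue_on_def by blast
      moreover have "emeasure lebesgue ?D < \<infinity>"
        using lmeasurable_compact[OF Kb(4)] unfolding fmeasurable_def by auto
      ultimately show ?thesis by (simp add: ennreal_mult_less_top)
    qed
    then have fin: "J \<noteq> \<infinity>" using NJ NN by (auto simp: ennreal_mult_top)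
    have "radial_profile ?D z = overlap_ratio K z" for z
      using profile_eq_overlap_ratio_if_integral_eq[OF K \<phi> ae pos JeqT[unfolded J_def T] fin[unfolded J_def]] .
    then have "measure lebesgue (overlap K z) = measure lebesgue K * radial_profile ?D z" for z
      using emeasure_convex_body(1)[OF K] by (simp add: overlap_ratio_def)
    then have "homothetic_overlaps K" by (rule homothetic_overlaps_if_measure_eq[OF K])
    then show ?thesis using const simplex_if_homothetic_overlaps[OF K] by simp
  qed
  have backward: "emeasure \<mu> ?D = ?N * T"
    if const: "constant_multiple_of_lebesgue_on \<mu> ?D" and sim: "int DIM('a) simplex K"
  proof -
    have "overlap_ratio K z = radial_profile ?D z" for z
    proof (rule antisym)
      show "overlap_ratio K z \<le> radial_profile ?D z"
        using measure_overlap_simplex[OF K sim, of z] emeasure_convex_body(1)[OF K]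
        by (simp add: overlap_ratio_def field_simps)
    qed (rule overlap_ratio_ge[OF K])
    then have "T = J" by (simp add: T J_def)
    moreover have "emeasure \<mu> ?D = ?N * J"
      using const unfolding J_def \<mu> by (rule emeasure_eq_profile_integral_if_constant[OF Kb(4-6) \<phi>])
    ultimately show ?thesis by simp
  qed
  show ?thesis
    unfolding min using order_trans[OF AJ NJT] forward backward by blast
qed

end
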